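(* Let $K$ be an algebraically closed field of characteristic zero. Let $E_{f,q}$ be an irreducible $K(\!(x)\!)$-connection, where $f\in K(\!(x^{1/q})\!)$ has class in $R_q^{o}(x)\setminus\{0\}$, with dual Puiseux characteristic $(q,p;\beta_1,\ldots,\beta_g)$ and associated integers $e_0=q,e_1,\ldots,e_g=1$. Then $E_{f,q}$ can be reduced to a rank $1$ connection by a finite iteration of local Fourier transforms and additions if and only if $$e_{i-1}\equiv \pm e_i \pmod{\beta_i}$$ for all $i=1,\ldots,g$.
   Context: For $q\in\mathbb{Z}_{>0}$ and $f\in K(\!(x^{1/q})\!)$, $E_{f,q}=(V,\nabla)$ is the $K(\!(x)\!)$-connection with $V=K(\!(x^{1/q})\!)$ regarded as a $K(\!(x)\!)$-vector space (so of rank $q$) and $\nabla(v)=(\frac{d}{dx}+x^{-1}f)v$. It is irreducible if $V$ has no proper nonzero $\nabla$-stable $K(\!(x)\!)$-subspace. The order $\operatorname{ord}(f)\in\frac1q\mathbb{Z}$ is the lowest exponent of $x$ occurring in $f$ with nonzero coefficient. Put $R_q(x)=K(\!(x^{1/q})\!)/\left(x^{1/q}K[\![x^{1/q}]\!]+\frac1q\mathbb{Z}\right)$, and let $R_q^{o}(x)$ be the set of elements of $R_q(x)$ that cannot be represented by elements of $K(\!(x^{1/r})\!)$ for any $0<r<q$. It is known that $E_{f,q}$ is irreducible iff the class of $f$ lies in $R_q^{o}(x)$, and that $E_{f,q}\cong E_{g,q}$ iff $f(x^{1/q})-g(\zeta_q^r x^{1/q})$ is zero in $R_q(x)$ for some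 $0\le r\le q-1$ ($\zeta_q$ a primitive $q$-th root of unity). Dual Puiseux characteristic: let $f=\sum_{i\ge n}a_i x^{i/q}$ have class in $R_q^{o}(x)\setminus\{0\}$ and $\operatorname{ord}(f)=-p/q$. Put $e_0=q$ and inductively define $\beta_k$ by $-\beta_k=\min\{i\mid a_i\ne0,\ e_{k-1}\nmid i\}$ and $e_k=\gcd(e_{k-1},\beta_k)$, until $e_g=1$ ($g=0$ if $q=1$). The sequence $(q,p;\beta_1,\ldots,\beta_g)$ is the dual Puiseux characteristic of $E_{f,q}$. Local Fourier transforms (defined for $f$ with class in $R_q^{o}\setminus\{0\}$, $\operatorname{ord}(f)=-p/q$), in the explicit form of Fang and Sabbah, everything up to isomorphism; $t$ denotes the $q$-th root of the source variable, $f=f(t)\in K(\!(t)\!)$ with $\operatorname{ord}_t f=-p$, and $\theta$ is a root of the target variable: (1) $\mathcal{F}^{(0,\infty)}(E_{f,q})=E_{h,p+q}$, where $\theta\in tK[\![t]\!]$ solves $\theta^{p+q}=-t^q/f(t)$, the series is inverted to $t=t(\theta)$, and $h(\theta)=f(t(\theta))+\frac{p}{2(p+q)}$. (In terms of variables: $f=-z\hat z$, source variable $z=t^q$, target variable $\hat\zeta=1/\hat z=\theta^{p+q}$.) (2) If $p<q$: $\mathcal{F}^{(\infty,0)}(E_{f,q})=E_{h,q-p}$, where $\theta^{q-p}=t^q f(t)$ and $h(\theta)=-f(t(\theta))+\frac{p}{2(q-p)}$. ($f=z\hat z$, source variable $\zeta=1/z=t^q$, target variable $\hat z=\theta^{q-p}$.)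 (3) If $p>q$: $\mathcal{F}^{(\infty,\infty)}(E_{f,q})=E_{h,p-q}$, where $\theta^{p-q}=1/(t^q f(t))$ and $h(\theta)=-f(t(\theta))+\frac{p}{2(p-q)}$. ($f=z\hat z$, source variable $\zeta=1/z=t^q$, target variable $\hat\zeta=1/\hat z=\theta^{p-q}$.) In each case the result is again of the form $E_{h,q'}$ with $h$ of class in $R_{q'}^{o}$, and the target variable is renamed $x$ so that operations can be iterated. Addition: passing from $E_{f,q}$ to $E_{f,q}\otimes\left(K(\!(x)\!),\frac{d}{dx}+ax^{-n-1}\right)\cong E_{f+ax^{-n},q}$ with $a\in K$ and $n$ an integer. "Reduced to a rank 1 connection" means that some finite sequence of the operations $\mathcal{F}^{(0,\infty)},\mathcal{F}^{(\infty,0)},\mathcal{F}^{(\infty,\infty)}$ (each applied only where defined) and additions transforms $E_{f,q}$ into a connection of rank 1. *)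

theory Defs
  imports
    "HOL-Computational_Algebra.Computational_Algebra"
    "HOL-Number_Theory.Cong"
begin

text \<open>
  The field \<open>K((x\<^sup>1\<^sup>/\<^sup>q))\<close> is the type \<open>'a fls\<close>, its variable being \<open>t = x\<^sup>1\<^sup>/\<^sup>q\<close>; the type does not record
  \<open>q\<close>, which is therefore an explicit parameter. The base field \<open>K((x))\<close> is \<open>'a fls\<close> with variable \<open>x\<close>,
  embedded into \<open>K((x\<^sup>1\<^sup>/\<^sup>q))\<close> by \<open>c \<mapsto> fls_compose_power c q\<close>, that is \<open>x = t\<^sup>q\<close>.
\<close>

section \<open>Connections over \<open>K((x))\<close>\<close>

record ('k, 'v) connection =
  cscale :: "'k \<Rightarrow> 'v \<Rightarrow> 'v"
  nabla :: "'v \<Rightarrow> 'v"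

definition is_connection ::
  "('a::field_char_0 fls, 'v::ab_group_add) connection \<Rightarrow> bool" where
  "is_connection M \<longleftrightarrow>
     vector_space (cscale M) \<and>
     (\<exists>B. finite B \<and> module.span (cscale M) B = UNIV) \<and>
     (\<forall>v w. nabla M (v + w) = nabla M v + nabla M w) \<and>
     (\<forall>c v. nabla M (cscale M c v) = cscale M (fls_deriv c) v + cscale M c (nabla M v))"

definition conn_rank ::
  "('a::field_char_0 fls, 'v::ab_group_add) connection \<Rightarrow> nat" where
  "conn_rank M = vector_space.dim (cscale M) UNIV"

definition conn_irreducible ::
  "('a::field_char_0 fls, 'v::ab_group_add) connection \<Rightarrow> bool" where
  "conn_irreducible M \<longleftrightarrow>
     is_connection M \<and>
     \<not> (\<exists>W. module.subspace (cscale M) W \<and> nabla M ` W \<subseteq> W \<and> W \<noteq> {0} \<and> W \<noteq> UNIV)"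

definition conn_iso ::
  "('a::field_char_0 fls, 'v::ab_group_add) connection \<Rightarrow>
   ('a fls, 'w::ab_group_add) connection \<Rightarrow> bool" (infix \<open>\<simeq>\<^sub>c\<close> 50) where
  "M \<simeq>\<^sub>c N \<longleftrightarrow>
     (\<exists>\<phi>. Vector_Spaces.linear (cscale M) (cscale N) \<phi> \<and> bij \<phi> \<and>
          (\<forall>v. \<phi> (nabla M v) = nabla N (\<phi> v)))"

text \<open>
  Since \<open>x = t\<^sup>q\<close>, the derivation \<open>d/dx\<close> of \<open>K((x\<^sup>1\<^sup>/\<^sup>q))\<close> is \<open>(q t\<^sup>q\<^sup>-\<^sup>1)\<^sup>-\<^sup>1 d/dt\<close>.
\<close>

definition conn_E :: "'a::field_char_0 fls \<Rightarrow> nat \<Rightarrow> ('a fls, 'a fls) connection" where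
  "conn_E f q =
     \<lparr>cscale = (\<lambda>c v. fls_compose_power c q * v),
      nabla = (\<lambda>v. fls_deriv v / (of_nat q * fls_X ^ (q - 1)) + f / fls_X ^ q * v)\<rparr>"

lemma is_connection_conn_E:
  fixes f :: "'a::field_char_0 fls"
  assumes q: "q > 0"
  shows "is_connection (conn_E f q)"
proof -
  let ?s = "\<lambda>c v :: 'a fls. fls_compose_power c q * v"
  interpret vector_space ?s
    using q by unfold_locales (auto simp: algebra_simps)
  have span: "span ((\<lambda>i. fls_X ^ i) ` {..<q}) = UNIV"
  proof (intro equalityI subsetI UNIV_I)
    fix v :: "'a fls"
    define c where "c i = Abs_fls (\<lambda>j. fls_nth v (int q * j + int i))" for i
    have c: "fls_nth (c i) j = fls_nth v (int q * j + int i)" for i j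
    proof -
      have "fls_nth v (int q * j + int i) = 0" if "j < min 0 (fls_subdegree v) - int i" for j
      proof -
        have "int q * j \<le> 1 * j"
          using that q by (intro mult_right_mono_neg) auto
        thus ?thesis using that by (intro fls_eq0_below_subdegree) auto
      qed
      thus ?thesis unfolding c_def by (intro nth_Abs_fls_lower_bound[where N = "min 0 (fls_subdegree v) - int i"]) auto
    qed
    have nth: "fls_nth (?s (c i) (fls_X ^ i)) n = (if i = nat (n mod int q) then fls_nth v n else 0)"
      if "i < q" for i n
    proof -
      have "fls_nth (?s (c i) (fls_X ^ i)) n = fls_nth (fls_compose_power (c i) q) (n - int i)"
        by (simp add: fls_X_power_times_conv_shift)
      also have "\<dots> = (if int q dvd n - int i then fls_nth v (int q * ((n - int i) div int q) + int i) else 0)"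
        using q by (simp add: fls_nth_compose_power c)
      also have "int q dvd n - int i \<longleftrightarrow> i = nat (n mod int q)"
      proof -
        have "int q dvd n - int i \<longleftrightarrow> n mod int q = int i mod int q"
          by (simp add: mod_eq_dvd_iff)
        also have "int i mod int q = int i" using that by simp
        finally show ?thesis using q by (auto simp: nat_eq_iff)
      qed
      finally show ?thesis using q
        by (auto simp: minus_mod_eq_mult_div [symmetric])
    qed
    have "v = (\<Sum>i<q. ?s (c i) (fls_X ^ i))"
    proof (rule fls_eqI)
      fix n
      have "nat (n mod int q) < q" using q by (simp add: nat_less_iff)
      thus "fls_nth v n = fls_nth (\<Sum>i<q. ?s (c i) (fls_X ^ i)) n"
        by (simp add: fls_nth_sum nth)
    qed
    also have "\<dots> \<in> span ((\<lambda>i. fls_X ^ i) ` {..<q})"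
      by (intro span_sum span_scale span_base) auto
    finally show "v \<in> span ((\<lambda>i. fls_X ^ i) ` {..<q})" .
  qed
  have deriv: "fls_deriv (fls_compose_power c q) / (of_nat q * fls_X ^ (q - 1)) =
                 fls_compose_power (fls_deriv c) q" for c :: "'a fls"
  proof -
    have "fls_deriv (fls_compose_power c q) =
            fls_compose_power (fls_deriv c) q * (of_nat q * fls_X ^ (q - 1))"
    proof (rule fls_eqI)
      fix n
      have dvd: "int q dvd n - (int q - 1) \<longleftrightarrow> int q dvd n + 1"
        using dvd_add_right_iff[of "int q" "- int q" "n + 1"] by (simp add: algebra_simps)
      have "fls_nth (fls_compose_power (fls_deriv c) q * (of_nat q * fls_X ^ (q - 1))) n =
              of_nat q * fls_nth (fls_compose_power (fls_deriv c) q) (n - (int q - 1))"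
        (is "fls_nth (?d * _) n = _")
      proof -
        have "?d * (of_nat q * fls_X ^ (q - 1)) = of_nat q * (?d * fls_X ^ (q - 1))"
          by (simp only: mult_ac)
        thus ?thesis
          using q by (simp add: fls_X_power_times_conv_shift(2) of_nat_diff algebra_simps)
      qed
      also have "\<dots> = of_int (n + 1) * fls_nth (fls_compose_power c q) (n + 1)"
      proof (cases "int q dvd n + 1")
        case True
        then obtain k where k: "n + 1 = int q * k" by (elim dvdE)
        hence n: "n - (int q - 1) = int q * (k - 1)" by (simp add: algebra_simps)
        have "fls_nth (fls_compose_power (fls_deriv c) q) (n - (int q - 1)) = of_int k * fls_nth c k"
          unfolding n using q by (simp add: fls_nth_compose_power)
        thus ?thesis unfolding k using q by (simp add: fls_nth_compose_power)
      next
        case False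
        thus ?thesis using q dvd by (simp add: fls_nth_compose_power)
      qed
      finally show "fls_nth (fls_deriv (fls_compose_power c q)) n =
          fls_nth (fls_compose_power (fls_deriv c) q * (of_nat q * fls_X ^ (q - 1))) n"
        by simp
    qed
    thus ?thesis using q by simp
  qed
  have "\<exists>B. finite B \<and> span B = UNIV"
    using span by (intro exI[of _ "(\<lambda>i. fls_X ^ i) ` {..<q}"]) simp
  moreover have "nabla (conn_E f q) (v + w) = nabla (conn_E f q) v + nabla (conn_E f q) w" for v w
    by (simp add: conn_E_def algebra_simps add_divide_distrib)
  moreover have "nabla (conn_E f q) (?s c v) = ?s (fls_deriv c) v + ?s c (nabla (conn_E f q) v)" for c v
    by (simp add: conn_E_def algebra_simps add_divide_distrib flip: deriv)
  ultimately show ?thesis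
    using vector_space_axioms unfolding is_connection_def by (simp add: conn_E_def)
qed

text \<open>
  The tensor product of \<open>M\<close> with the rank one connection \<open>(K((x)), d/dx + b)\<close>, its underlying
  vector space being identified with that of \<open>M\<close> by \<open>v \<otimes> 1 \<mapsto> v\<close>.
\<close>

definition tensor_rank_one ::
  "('a::field_char_0 fls, 'v::ab_group_add) connection \<Rightarrow> 'a fls \<Rightarrow> ('a fls, 'v) connection" where
  "tensor_rank_one M b =
     \<lparr>cscale = cscale M, nabla = (\<lambda>v. nabla M v + cscale M b v)\<rparr>"


section \<open>The groups \<open>R\<^sub>q(x)\<close>\<close>

definition R_null :: "nat \<Rightarrow> 'a::field_char_0 fls set" where
  "R_null q = {fps_to_fls (fps_X * w) + fls_const (of_int n / of_nat q) | w n. True}"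

definition R_class :: "nat \<Rightarrow> 'a::field_char_0 fls \<Rightarrow> 'a fls set" where
  "R_class q f = {g. f - g \<in> R_null q}"

text \<open>
  The elements of \<open>K((x\<^sup>1\<^sup>/\<^sup>q))\<close> that lie in \<open>K((x\<^sup>1\<^sup>/\<^sup>r))\<close>: every exponent \<open>i/q\<close> of \<open>x\<close> lies in \<open>(1/r)\<int>\<close>.
  Here \<open>r\<close> need not divide \<open>q\<close>.
\<close>

definition in_root_field :: "nat \<Rightarrow> nat \<Rightarrow> 'a::field_char_0 fls \<Rightarrow> bool" where
  "in_root_field q r g \<longleftrightarrow> (\<forall>i. fls_nth g i \<noteq> 0 \<longrightarrow> int q dvd int r * i)"

definition R_o :: "nat \<Rightarrow> 'a::field_char_0 fls set set" where
  "R_o q = {C \<in> range (R_class q). \<not> (\<exists>r g. 0 < r \<and> r < q \<and> g \<in> C \<and> in_root_field q r g)}"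


section \<open>Dual Puiseux characteristic\<close>

text \<open>
  \<open>\<beta> k\<close> and \<open>e k\<close> matter only for \<open>1 \<le> k \<le> g\<close> and \<open>0 \<le> k \<le> g\<close>, respectively.
  The minima are negative if the class of \<open>f\<close> is in \<open>R_o q\<close>, so natural numbers suffice for \<open>\<beta>\<close>.
\<close>

definition dual_puiseux_char ::
  "'a::field_char_0 fls \<Rightarrow> nat \<Rightarrow> nat \<Rightarrow> nat \<Rightarrow> (nat \<Rightarrow> nat) \<Rightarrow> (nat \<Rightarrow> nat) \<Rightarrow> bool" where
  "dual_puiseux_char f q p g \<beta> e \<longleftrightarrow>
     f \<noteq> 0 \<and> fls_subdegree f = - int p \<and>
     e 0 = q \<and>
     (\<forall>k\<in>{1..g}.
        (let S = {i. fls_nth f i \<noteq> 0 \<and> \<not> int (e (k - 1)) dvd i}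
         in - int (\<beta> k) \<in> S \<and> (\<forall>i\<in>S. - int (\<beta> k) \<le> i)) \<and>
        e k = gcd (e (k - 1)) (\<beta> k)) \<and>
     (\<forall>k<g. e k \<noteq> 1) \<and> e g = 1"


section \<open>Local Fourier transforms and additions\<close>

text \<open>
  The domain of the local Fourier transforms; \<open>p\<close> is given by \<open>ord f = -p/q\<close>.
\<close>

definition lft_source :: "'a::field_char_0 fls \<Rightarrow> nat \<Rightarrow> nat \<Rightarrow> bool" where
  "lft_source f q p \<longleftrightarrow>
     q > 0 \<and> R_class q f \<in> R_o q - {R_class q 0} \<and> fls_subdegree f = - int p"

text \<open>
  The transforms are relations between connections, closed under isomorphism on both sides.
  The series \<open>\<theta>\<close> in \<open>t\<close> has order 1 and is determined up to a root of unity; its compositional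
  inverse \<^term>\<open>fps_inv \<theta>\<close> is \<open>t\<close> as a series in \<open>\<theta>\<close>.
\<close>

definition lft_0_inf ::
  "('a::field_char_0 fls, 'a fls) connection \<Rightarrow> ('a fls, 'a fls) connection \<Rightarrow> bool" where
  "lft_0_inf M N \<longleftrightarrow>
     (\<exists>f q p \<theta>. lft_source f q p \<and> M \<simeq>\<^sub>c conn_E f q \<and>
        fps_nth \<theta> 0 = 0 \<and> fps_to_fls \<theta> ^ (p + q) = - (fls_X ^ q / f) \<and>
        N \<simeq>\<^sub>c conn_E
          (fls_compose_fps f (fps_inv \<theta>) + fls_const (of_nat p / (2 * of_nat (p + q))))
          (p + q))"

definition lft_inf_0 ::
  "('a::field_char_0 fls, 'a fls) connection \<Rightarrow> ('a fls, 'a fls) connection \<Rightarrow> bool" where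
  "lft_inf_0 M N \<longleftrightarrow>
     (\<exists>f q p \<theta>. lft_source f q p \<and> p < q \<and> M \<simeq>\<^sub>c conn_E f q \<and>
        fps_nth \<theta> 0 = 0 \<and> fps_to_fls \<theta> ^ (q - p) = fls_X ^ q * f \<and>
        N \<simeq>\<^sub>c conn_E
          (- fls_compose_fps f (fps_inv \<theta>) + fls_const (of_nat p / (2 * of_nat (q - p))))
          (q - p))"

definition lft_inf_inf ::
  "('a::field_char_0 fls, 'a fls) connection \<Rightarrow> ('a fls, 'a fls) connection \<Rightarrow> bool" where
  "lft_inf_inf M N \<longleftrightarrow>
     (\<exists>f q p \<theta>. lft_source f q p \<and> p > q \<and> M \<simeq>\<^sub>c conn_E f q \<and>
        fps_nth \<theta> 0 = 0 \<and> fps_to_fls \<theta> ^ (p - q) = 1 / (fls_X ^ q * f) \<and>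
        N \<simeq>\<^sub>c conn_E
          (- fls_compose_fps f (fps_inv \<theta>) + fls_const (of_nat p / (2 * of_nat (p - q))))
          (p - q))"

definition conn_addition ::
  "('a::field_char_0 fls, 'a fls) connection \<Rightarrow> ('a fls, 'a fls) connection \<Rightarrow> bool" where
  "conn_addition M N \<longleftrightarrow>
     (\<exists>(a::'a) (n::int). N \<simeq>\<^sub>c tensor_rank_one M (fls_const a * fls_X_intpow (- n - 1)))"

definition reduces_to_rank_one ::
  "('a::field_char_0 fls, 'a fls) connection \<Rightarrow> bool" where
  "reduces_to_rank_one M \<longleftrightarrow>
     (\<exists>N. (\<lambda>A B. lft_0_inf A B \<or> lft_inf_0 A B \<or> lft_inf_inf A B \<or> conn_addition A B)\<^sup>*\<^sup>* M N \<and>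
          conn_rank N = 1)"

end

theory Submission
  imports Defs
begin

text \<open>
  Attach to \<open>f\<close> and \<open>q\<close> the function \<open>D(n) = gcd(q, {j > n. a\<^sub>-\<^sub>j \<noteq> 0})\<close>. It is constant except at the
  \<open>\<beta>\<^sub>k\<close>, where it drops from \<open>e\<^sub>k\<^sub>-\<^sub>1\<close> to \<open>e\<^sub>k\<close>, so the congruences of the theorem say that
  \<open>D(i) \<equiv> \<plusminus>D(i - 1)\<close> modulo \<open>i\<close> for all \<open>i > 0\<close>. Isomorphisms and additions do not change \<open>D\<close>. A local
  Fourier transform turns \<open>f = c t\<^sup>a \<theta>\<^sup>b\<close> into \<open>c' \<theta>\<^sup>b t\<^sup>a\<close> plus a constant, read as a series in \<open>\<theta>\<close>, with
  \<open>\<bar>a\<bar>\<close> and \<open>\<bar>b\<bar>\<close> the ranks and \<open>a + b = -p\<close>. The first exponent of \<open>\<theta>/t\<close> not divisible by \<open>d\<close> is the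
  same whether this unit is expanded in \<open>t\<close> or in \<open>\<theta>\<close>, so \<open>D\<close> is unchanged below \<open>p\<close>, and from \<open>p\<close> on
  only the rank changes, to a number congruent to \<open>\<plusminus>q\<close> modulo \<open>p\<close>. Hence the congruences are preserved
  in both directions, and they are trivial in rank one. Conversely, additions remove the exponents
  divisible by \<open>q\<close>; then \<open>p = \<beta>\<^sub>1\<close>, and \<open>\<F>(\<infinity>,0)\<close> if \<open>p < q\<close>, or \<open>\<F>(\<infinity>,\<infinity>)\<close> if \<open>p > q\<close>, where the first
  congruence forces \<open>p = q + e\<^sub>1\<close>, lowers the rank.
\<close>

section \<open>Supports of power series and roots of unity\<close>

text \<open>The derivative of \<open>X^n - 1\<close> vanishes only at 0, which is not a root, so all
  roots are simple; over an algebraically closed field their number is then the degree.\<close>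

lemma card_roots_of_unity:
  assumes "n > 0"
  shows "card {z :: 'a :: {alg_closed_field, field_char_0}. z ^ n = 1} = n"
proof -
  define p :: "'a poly" where "p = monom 1 n - 1"
  have deg: "degree p = n"
    using degree_add_eq_left[of "-1" "monom (1::'a) n"] assms by (simp add: p_def degree_monom_eq)
  have [simp]: "p \<noteq> 0" using deg assms by auto
  have roots: "poly p z = 0 \<longleftrightarrow> z ^ n = 1" for z
    by (simp add: p_def poly_monom)
  have "rsquarefree p"
    unfolding rsquarefree_roots roots using assms
    by (auto simp: p_def pderiv_diff pderiv_monom poly_monom power_0_left)
  hence ord: "order z p = 1" if "z ^ n = 1" for z
    using that roots by (simp add: rsquarefree_root_order)
  obtain A where A: "size A = degree p" "p = smult (lead_coeff p) (\<Prod>x\<in>#A. [:-x, 1:])"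
    using alg_closed_imp_factorization[of p] by auto
  have nz: "(\<Prod>x\<in>#A. [:-x, 1:]) \<noteq> 0" for A :: "'a multiset"
    by (induction A) (auto simp: mult_eq_0_iff simp del: mult_pCons_left)
  have "proots p = proots (\<Prod>x\<in>#A. [:-x, 1:])"
    by (subst A(2)) (simp add: proots_smult)
  also have "\<dots> = (\<Sum>x\<in>#A. {#x#})"
    by (induction A) (auto simp: proots_mult nz simp del: mult_pCons_left prod_mset_zero_iff)
  finally have "size (proots p) = n"
    using A(1) deg by simp
  also have "size (proots p) = (\<Sum>z\<in>{z :: 'a. z ^ n = 1}. 1)"
    unfolding size_multiset_overloaded_eq
    by (intro sum.cong) (auto simp: roots ord)
  finally show ?thesis by simp
qed

text \<open>If every \<open>n\<close>-th root of unity is killed by \<open>i\<close>, it is also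
  killed by \<open>i mod n\<close>. For \<open>i mod n > 0\<close> this would place \<open>n\<close>
  elements among only \<open>i mod n\<close> roots of unity.\<close>

lemma dvd_iff_roots_of_unity:
  assumes "n > 0"
  shows "n dvd i \<longleftrightarrow> (\<forall>z :: 'a :: {alg_closed_field, field_char_0}. z ^ n = 1 \<longrightarrow> z ^ i = 1)"
proof
  assume *: "\<forall>z :: 'a. z ^ n = 1 \<longrightarrow> z ^ i = 1"
  have "z ^ (i mod n) = 1" if "z ^ n = 1" for z :: 'a
  proof -
    have "z ^ i = (z ^ n) ^ (i div n) * z ^ (i mod n)"
      by (simp flip: power_mult power_add)
    thus ?thesis using that * by simp
  qed
  hence sub: "{z :: 'a. z ^ n = 1} \<subseteq> {z. z ^ (i mod n) = 1}" by auto
  show "n dvd i"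
  proof (rule ccontr)
    assume "\<not> n dvd i"
    hence pos: "i mod n > 0" by (simp add: mod_greater_zero_iff_not_dvd)
    hence "n \<le> i mod n"
      using card_mono[OF _ sub] assms pos card_roots_of_unity[where 'a = 'a]
      by (metis card.infinite less_not_refl3)
    thus False using assms by (meson mod_less_divisor not_le)
  qed
qed (auto elim!: dvdE simp: power_mult)

section \<open>Congruences of power series modulo powers of the variable\<close>

definition agree :: "nat \<Rightarrow> 'a fps \<Rightarrow> 'a fps \<Rightarrow> bool" where
  "agree N u v \<longleftrightarrow> (\<forall>i<N. fps_nth u i = fps_nth v i)"

lemma agree_mult:
  fixes u :: "'a :: field fps"
  shows "agree N u v \<Longrightarrow> agree N u' v' \<Longrightarrow> agree N (u * u') (v * v')"
  unfolding agree_def fps_mult_nth by (auto intro!: sum.cong)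

lemma agree_power:
  fixes u :: "'a :: field fps"
  shows "agree N u v \<Longrightarrow> agree N (u ^ k) (v ^ k)"
  by (induction k) (auto intro: agree_mult simp: agree_def[of _ 1 1])

lemma agree_inverse:
  fixes u :: "'a :: field fps"
  assumes "agree N u v" "fps_nth u 0 \<noteq> 0" "fps_nth v 0 \<noteq> 0"
  shows "agree N (inverse u) (inverse v)"
proof -
  have "agree N (v * (inverse u * inverse v)) (u * (inverse u * inverse v))"
    using assms(1) by (intro agree_mult) (auto simp: agree_def)
  thus ?thesis
    using assms(2,3) inverse_mult_eq_1'[of u] inverse_mult_eq_1'[of v] 
    by (metis mult.left_commute mult.assoc mult_1_right)
qed

text \<open>In \<open>u^k - v^k = (u - v) * S\<close> the constant term of \<open>S\<close> is
  \<open>k * u(0)^(k-1)\<close>, nonzero in characteristic zero. Hence \<open>u - v\<close> and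
  \<open>u^k - v^k\<close> have the same order.\<close>

lemma agree_powerD:
  fixes u :: "'a :: field_char_0 fps"
  assumes "agree N (u ^ k) (v ^ k)" "k > 0" "fps_nth u 0 = fps_nth v 0" "fps_nth u 0 \<noteq> 0"
  shows "agree N u v"
proof (rule ccontr)
  assume neg: "\<not> agree N u v"
  define S where "S = (\<Sum>i<k. v ^ (k - Suc i) * u ^ i)"
  have S: "u ^ k - v ^ k = (u - v) * S"
    by (simp add: S_def power_diff_sumr2)
  have "fps_nth (v ^ (k - Suc i) * u ^ i) 0 = fps_nth u 0 ^ (k - 1)" if "i < k" for i
    using that assms(3) by (simp add: fps_nth_power_0 flip: power_add)
  hence "fps_nth S 0 = of_nat k * fps_nth u 0 ^ (k - 1)"
    unfolding S_def by (simp add: fps_sum_nth)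
  hence S0: "fps_nth S 0 \<noteq> 0" using assms by simp
  have uv: "u - v \<noteq> 0" using neg by (auto simp: agree_def)
  have "subdegree (u - v) < N"
  proof (rule ccontr)
    assume "\<not> subdegree (u - v) < N"
    hence "\<forall>i<N. fps_nth (u - v) i = 0"
      by (intro allI impI nth_less_subdegree_zero) auto
    thus False using neg by (auto simp: agree_def)
  qed
  moreover have "fps_nth (u ^ k - v ^ k) (subdegree (u - v)) = fps_nth (u - v) (subdegree (u - v)) * fps_nth S 0"
    unfolding S by (rule nth_subdegree_mult_left)
  moreover have "fps_nth (u - v) (subdegree (u - v)) \<noteq> 0"
    using uv by (rule nth_subdegree_nonzero)
  ultimately have "fps_nth (u ^ k - v ^ k) (subdegree (u - v)) \<noteq> 0"
    using S0 by simp
  thus False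
    using assms(1) \<open>subdegree (u - v) < N\<close> by (simp add: agree_def)
qed

lemma agree_compose_left:
  fixes a :: "'a :: field fps"
  shows "agree N a b \<Longrightarrow> agree N (a oo c) (b oo c)"
  unfolding agree_def fps_compose_nth by (auto intro!: sum.cong)

lemma agree_compose_right:
  fixes a :: "'a :: field fps"
  assumes "agree N a b"
  shows "agree N (c oo a) (c oo b)"
  using agree_power[OF assms] unfolding agree_def fps_compose_nth by auto

definition supported_below :: "nat \<Rightarrow> nat \<Rightarrow> 'a::zero fps \<Rightarrow> bool" where
  "supported_below d N u \<longleftrightarrow> (\<forall>i<N. fps_nth u i \<noteq> 0 \<longrightarrow> d dvd i)"

abbreviation rotate_fps :: "'a::field \<Rightarrow> 'a fps \<Rightarrow> 'a fps" where
  "rotate_fps z u \<equiv> u oo (fps_const z * fps_X)"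

text \<open>
  Reduces divisibility of exponents to congruences between power series, which are compatible with
  products, roots and composition.
\<close>

lemma supported_below_iff_rotate:
  fixes u :: "'a :: {alg_closed_field, field_char_0} fps"
  assumes "d > 0"
  shows "supported_below d N u \<longleftrightarrow> (\<forall>z. z ^ d = 1 \<longrightarrow> agree N (rotate_fps z u) u)"
  unfolding supported_below_def agree_def fps_compose_linear dvd_iff_roots_of_unity[where 'a = 'a, OF assms]
  by auto

text \<open>Rotation commutes with powers and keeps the constant term, so the rotation criterion
  passes from \<open>u\<close> to \<open>u ^ k\<close>, and back by extracting roots with
  \<open>agree_powerD\<close>.\<close>

lemma supported_below_power:
  fixes u :: "'a :: {alg_closed_field, field_char_0} fps"
  assumes "d > 0" "k > 0" "fps_nth u 0 \<noteq> 0"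
  shows "supported_below d N (u ^ k) \<longleftrightarrow> supported_below d N u"
proof -
  have "agree N (rotate_fps z (u ^ k)) (u ^ k) \<longleftrightarrow> agree N (rotate_fps z u) u" for z
    using assms agree_power[of N "rotate_fps z u" u k] agree_powerD[of N "rotate_fps z u" k u]
    by (auto simp: fps_compose_power [symmetric])
  thus ?thesis using assms by (simp add: supported_below_iff_rotate)
qed

lemma supported_below_inverse:
  fixes u :: "'a :: {alg_closed_field, field_char_0} fps"
  assumes "d > 0" "fps_nth u 0 \<noteq> 0"
  shows "supported_below d N (inverse u) \<longleftrightarrow> supported_below d N u"
proof -
  have *: "agree N (rotate_fps z (inverse u)) (inverse u)" 
    if "agree N (rotate_fps z u) u" "fps_nth u 0 \<noteq> 0" for z :: 'a and u :: "'a fps"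
    using agree_inverse[OF that(1)] that(2) by (simp add: fps_inverse_compose)
  have "agree N (rotate_fps z (inverse u)) (inverse u) \<longleftrightarrow> agree N (rotate_fps z u) u" for z
    using *[where z = z and u = u] *[where z = z and u = "inverse u"] assms by auto
  thus ?thesis using assms by (simp add: supported_below_iff_rotate)
qed

text \<open>For \<open>\<theta> = fps_X * u\<close> the rotation criterion says
  \<open>\<theta>(z t) = z \<theta>(t)\<close> up to the given order. Composing with the inverse
  series on both sides turns this into the same relation for the inverse.\<close>

lemma supported_below_compinv:
  fixes u w :: "'a :: {alg_closed_field, field_char_0} fps"
  assumes d: "d > 0"
    and inv: "(fps_X * u) oo (fps_X * w) = fps_X" "(fps_X * w) oo (fps_X * u) = fps_X"
    and u: "supported_below d N u"
  shows "supported_below d N w"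
  unfolding supported_below_def
proof (intro allI impI)
  fix i assume i: "i < N" "fps_nth w i \<noteq> 0"
  define \<theta> \<tau> where "\<theta> = fps_X * u" and "\<tau> = fps_X * w"
  have [simp]: "fps_nth \<theta> 0 = 0" "fps_nth \<tau> 0 = 0" by (auto simp: \<theta>_def \<tau>_def)
  have "z ^ i = 1" if z: "z ^ d = 1" for z :: 'a
  proof -
    have "z \<noteq> 0" using z d by (auto simp: power_0_left)
    \<comment> \<open>The bound is \<open>Suc N\<close> because the factor \<open>fps_X\<close>
      raises every exponent of \<open>u\<close> by one.\<close>
    have "agree (Suc N) (rotate_fps z \<theta>) (fps_const z * \<theta>)"
      unfolding agree_def
    proof (intro allI impI)
      fix j assume "j < Suc N"
      thus "fps_nth (rotate_fps z \<theta>) j = fps_nth (fps_const z * \<theta>) j"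
        using u z unfolding supported_below_def fps_compose_linear \<theta>_def
        by (cases j) (auto simp: dvd_def power_mult)
    qed
    hence "agree (Suc N) ((rotate_fps z \<theta>) oo \<tau>) ((fps_const z * \<theta>) oo \<tau>)"
      by (rule agree_compose_left)
    also have "(fps_const z * \<theta>) oo \<tau> = fps_const z * fps_X"
      using inv by (simp add: fps_compose_mult_distrib \<theta>_def \<tau>_def)
    also have "(rotate_fps z \<theta>) oo \<tau> = \<theta> oo (fps_const z * \<tau>)"
      by (subst fps_compose_assoc [symmetric]) (auto simp: fps_compose_mult_distrib)
    finally have "agree (Suc N) (\<tau> oo (\<theta> oo (fps_const z * \<tau>))) (rotate_fps z \<tau>)"
      by (rule agree_compose_right)
    also have "\<tau> oo (\<theta> oo (fps_const z * \<tau>)) = fps_const z * \<tau>"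
      using inv by (subst fps_compose_assoc) (auto simp: \<theta>_def \<tau>_def)
    finally have "z * fps_nth w i = z ^ Suc i * fps_nth w i"
      using i unfolding agree_def fps_compose_linear \<tau>_def
      by (auto dest!: spec[of _ "Suc i"])
    thus ?thesis using \<open>z \<noteq> 0\<close> i by simp
  qed
  thus "d dvd i" by (simp add: dvd_iff_roots_of_unity[where 'a = 'a, OF d])
qed

section \<open>Integer powers of invertible power series\<close>

definition fps_powi :: "'a::field fps \<Rightarrow> int \<Rightarrow> 'a fps" where
  "fps_powi u b = (if b \<ge> 0 then u ^ nat b else inverse u ^ nat (- b))"

lemma fps_powi_nth_0:
  assumes "fps_nth u 0 \<noteq> 0"
  shows "fps_nth (fps_powi u b) 0 \<noteq> 0"
  using assms by (auto simp: fps_powi_def fps_nth_power_0)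

lemma fls_powi_conv_fps_powi:
  assumes "fps_nth u 0 \<noteq> 0"
  shows "fps_to_fls (fps_X * u) powi b = fls_X_intpow b * fps_to_fls (fps_powi u b)"
proof -
  have "inverse (fps_to_fls u) = fps_to_fls (inverse u)"
    using assms by (simp add: fls_inverse_fps_to_fls subdegree_eq_0)
  hence "fps_to_fls u powi b = fps_to_fls (fps_powi u b)"
    by (simp add: fps_powi_def power_int_def fps_to_fls_power)
  thus ?thesis
    by (simp add: fls_times_fps_to_fls power_int_mult_distrib)
qed

lemma supported_below_powi:
  fixes u :: "'a :: {alg_closed_field, field_char_0} fps"
  assumes "d > 0" "b \<noteq> 0" "fps_nth u 0 \<noteq> 0"
  shows "supported_below d N (fps_powi u b) \<longleftrightarrow> supported_below d N u"
  using assms by (simp add: fps_powi_def supported_below_power supported_below_inverse)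

section \<open>Greatest common divisors of polar exponents\<close>

text \<open>This is D(n). The strict bound \<open>n < j\<close> means that passing from D(i) to D(i
  - 1) takes exactly the exponent \<open>-i\<close> into account.\<close>

definition exp_gcd :: "'a::zero fls \<Rightarrow> nat \<Rightarrow> nat \<Rightarrow> nat" where
  "exp_gcd f q n = Gcd (insert q {j. n < j \<and> fls_nth f (- int j) \<noteq> 0})"

definition pm_cong :: "nat \<Rightarrow> nat \<Rightarrow> nat \<Rightarrow> bool" where
  "pm_cong a b m \<longleftrightarrow> [int a = int b] (mod int m) \<or> [int a = - int b] (mod int m)"

text \<open>Quantifying over all \<open>i\<close> avoids tracking the characteristic exponents
  through the operations; where D does not change, the condition is trivial.\<close>

definition gcds_pm_cong :: "'a::zero fls \<Rightarrow> nat \<Rightarrow> bool" where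
  "gcds_pm_cong f q \<longleftrightarrow> (\<forall>i>0. pm_cong (exp_gcd f q i) (exp_gcd f q (i - 1)) i)"

lemma pm_cong_refl [simp]: "pm_cong a a m"
  by (simp add: pm_cong_def)

text \<open>As \<open>d < a < m\<close> are different residues, only the minus sign is possible, and
  \<open>a + d\<close> is then a multiple of \<open>m\<close> strictly between 0 and
  \<open>2 * m\<close>.\<close>

lemma pm_cong_less_imp_eq:
  assumes "pm_cong a d m" "d < a" "a < m"
  shows "m = a + d"
  using assms(1) unfolding pm_cong_def
proof
  assume "[int a = int d] (mod int m)"
  thus ?thesis using assms(2,3) by (simp add: cong_def)
next
  assume "[int a = - int d] (mod int m)"
  hence "int m dvd int a + int d" by (simp add: cong_iff_dvd_diff)
  hence "m dvd a + d" by (metis int_dvd_int_iff of_nat_add)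
  then obtain k where k: "a + d = m * k" by (elim dvdE)
  have "m * k < m * 2" "0 < m * k" using assms(2,3) k by linarith+
  hence "k = 1" by simp
  thus ?thesis using k by simp
qed

lemma dvd_exp_gcd_iff:
  "d dvd exp_gcd f q n \<longleftrightarrow> d dvd q \<and> (\<forall>j>n. fls_nth f (- int j) \<noteq> 0 \<longrightarrow> d dvd j)"
  by (auto simp: exp_gcd_def dvd_Gcd_iff)

lemma nat_eq_iff_dvd: "(\<And>d. d dvd a \<longleftrightarrow> d dvd b) \<Longrightarrow> a = (b :: nat)"
  by (meson dvd_antisym dvd_refl)

lemma exp_gcd_mono: "n \<le> m \<Longrightarrow> exp_gcd f q n dvd exp_gcd f q m"
proof -
  assume "n \<le> m"
  moreover have "exp_gcd f q n dvd q" "\<And>j. j > n \<Longrightarrow> fls_nth f (- int j) \<noteq> 0 \<Longrightarrow> exp_gcd f q n dvd j"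
    using dvd_exp_gcd_iff[of "exp_gcd f q n" f q n] by auto
  ultimately show ?thesis
    unfolding dvd_exp_gcd_iff[of _ f q m] by auto
qed

lemma exp_gcd_eq_rank:
  assumes "\<And>j. j > n \<Longrightarrow> fls_nth f (- int j) = 0"
  shows "exp_gcd f q n = q"
  by (rule nat_eq_iff_dvd) (use assms in \<open>auto simp: dvd_exp_gcd_iff\<close>)

lemma exp_gcd_ge_pole:
  assumes "fls_subdegree f = - int p" "p \<le> n"
  shows "exp_gcd f q n = q"
  using assms by (intro exp_gcd_eq_rank fls_eq0_below_subdegree) auto

lemma exp_gcd_pred:
  assumes "i > 0"
  shows "exp_gcd f q (i - 1) =
    (if fls_nth f (- int i) = 0 then exp_gcd f q i else gcd (exp_gcd f q i) i)"
proof (rule nat_eq_iff_dvd)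
  have "(j > i - 1) \<longleftrightarrow> j = i \<or> j > i" for j using assms by auto
  thus "d dvd exp_gcd f q (i - 1) \<longleftrightarrow>
     d dvd (if fls_nth f (- int i) = 0 then exp_gcd f q i else gcd (exp_gcd f q i) i)" for d
    by (auto simp: dvd_exp_gcd_iff)
qed

text \<open>Since \<open>q\<close> itself enters the gcd, coefficients at multiples of
  \<open>q\<close> have no influence. This gives invariance under additions.\<close>

lemma exp_gcd_cong:
  assumes "\<And>j. j > 0 \<Longrightarrow> \<not> q dvd j \<Longrightarrow> fls_nth f (- int j) = fls_nth h (- int j)"
  shows "exp_gcd f q = exp_gcd h q"
proof (intro ext nat_eq_iff_dvd)
  show "d dvd exp_gcd f q n \<longleftrightarrow> d dvd exp_gcd h q n" for d n
    unfolding dvd_exp_gcd_iff using assms by (metis dvd_trans gr0I less_zeroE)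
qed

lemma gcds_pm_cong_cong: "exp_gcd f q = exp_gcd h q \<Longrightarrow> gcds_pm_cong f q \<longleftrightarrow> gcds_pm_cong h q"
  by (simp add: gcds_pm_cong_def)

lemma gcds_pm_cong_rank_1: "gcds_pm_cong f 1"
proof -
  have "exp_gcd f 1 n = 1" for n
    using dvd_exp_gcd_iff[of "exp_gcd f 1 n" f 1 n] by simp
  thus ?thesis by (simp add: gcds_pm_cong_def)
qed

lemma fls_nth_pole:
  fixes f :: "'a :: field fls"
  assumes f: "f = fls_const c * fls_X_intpow (- int p) * fps_to_fls v"
  shows "fls_nth f (- int j) = (if j \<le> p then c * fps_nth v (p - j) else 0)"
proof -
  have "f = fls_const c * fls_shift (int p) (fps_to_fls v)"
    unfolding f mult.assoc by (simp add: fls_X_intpow_times_conv_shift(1)[of "- int p", simplified])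
  moreover have "nat (int p - int j) = p - j" by simp
  ultimately show ?thesis by auto
qed

text \<open>The coefficient of \<open>f\<close> at \<open>-j\<close> is a nonzero multiple of that
  of \<open>v\<close> at \<open>p - j\<close>, and for \<open>d dvd p\<close> the numbers
  \<open>j\<close> and \<open>p - j\<close> are divisible by \<open>d\<close>
  simultaneously.\<close>

lemma support_iff_supported_below:
  fixes f :: "'a :: field fls"
  assumes f: "f = fls_const c * fls_X_intpow (- int p) * fps_to_fls v" and "c \<noteq> 0" "d dvd p"
  shows "(\<forall>j>n. fls_nth f (- int j) \<noteq> 0 \<longrightarrow> d dvd j) \<longleftrightarrow> supported_below d (p - n) v"
proof
  assume *: "\<forall>j>n. fls_nth f (- int j) \<noteq> 0 \<longrightarrow> d dvd j"
  show "supported_below d (p - n) v"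
    unfolding supported_below_def
  proof (intro allI impI)
    fix i assume i: "i < p - n" "fps_nth v i \<noteq> 0"
    hence "d dvd p - i"
      using * assms(2) fls_nth_pole[OF f, of "p - i"] by (auto dest!: spec[of _ "p - i"] simp del: of_nat_diff)
    hence "d dvd p - (p - i)" using assms(3) dvd_diff_nat by blast
    thus "d dvd i" using i by simp
  qed
next
  assume *: "supported_below d (p - n) v"
  show "\<forall>j>n. fls_nth f (- int j) \<noteq> 0 \<longrightarrow> d dvd j"
  proof (intro allI impI)
    fix j assume j: "n < j" "fls_nth f (- int j) \<noteq> 0"
    hence "d dvd p - j" "j \<le> p"
      using * by (auto simp: fls_nth_pole[OF f] supported_below_def split: if_splits)
    thus "d dvd j" using assms(3) by (metis dvd_diffD1)
  qed
qed

text \<open>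
  The common shape of the three transforms. It is symmetric up to exchanging \<open>(f, \<theta>, a)\<close> and
  \<open>(h, \<tau>, b)\<close>, apart from the constant \<open>k\<close>, which does not affect the polar part.
\<close>

locale stationary_phase =
  fixes f h :: "'a :: {alg_closed_field, field_char_0} fls" and \<theta> \<tau> :: "'a fps"
    and c c' k :: 'a and a b :: int and q q' p :: nat
  assumes \<theta>0: "fps_nth \<theta> 0 = 0" and \<tau>0: "fps_nth \<tau> 0 = 0"
    and inv: "\<theta> oo \<tau> = fps_X" "\<tau> oo \<theta> = fps_X"
    and c: "c \<noteq> 0" "c' \<noteq> 0"
    and f: "f = fls_const c * fls_X_intpow a * fps_to_fls \<theta> powi b"
    and h: "h = fls_const c' * fls_X_intpow b * fps_to_fls \<tau> powi a + fls_const k"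
    and a: "a \<noteq> 0" "nat \<bar>a\<bar> = q" and b: "b \<noteq> 0" "nat \<bar>b\<bar> = q'" and ab: "a + b = - int p"
begin

text \<open>Splitting off the variable from \<open>\<theta>\<close> and \<open>\<tau>\<close> leaves
  units \<open>u\<close> and \<open>w\<close>, and the monomials combine to the exponent
  \<open>a + b = -p\<close>. The series \<open>h0\<close> is \<open>h\<close> without the constant
  \<open>k\<close>.\<close>

lemma normal_forms:
  obtains u w h0 where "\<theta> = fps_X * u" "\<tau> = fps_X * w" "fps_nth u 0 \<noteq> 0" "fps_nth w 0 \<noteq> 0"
    "f = fls_const c * fls_X_intpow (- int p) * fps_to_fls (fps_powi u b)"
    "h0 = fls_const c' * fls_X_intpow (- int p) * fps_to_fls (fps_powi w a)"
    "\<forall>j>0. fls_nth h (- int j) = fls_nth h0 (- int j)"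
proof
  define u w where "u = fps_shift 1 \<theta>" and "w = fps_shift 1 \<tau>"
  show u: "\<theta> = fps_X * u" and w: "\<tau> = fps_X * w"
    using \<theta>0 \<tau>0 by (auto simp: u_def w_def fps_eq_iff)
  have "fps_nth (\<theta> oo \<tau>) 1 = fps_nth \<theta> 1 * fps_nth \<tau> 1"
    using \<theta>0 by (simp add: fps_compose_nth)
  thus uw0: "fps_nth u 0 \<noteq> 0" "fps_nth w 0 \<noteq> 0"
    using inv by (auto simp: u_def w_def)
  define h0 where "h0 = fls_const c' * fls_X_intpow b * fps_to_fls \<tau> powi a"
  show "f = fls_const c * fls_X_intpow (- int p) * fps_to_fls (fps_powi u b)"
    unfolding f u fls_powi_conv_fps_powi[OF uw0(1)] ab[symmetric] fls_X_intpow_times_fls_X_intpow[symmetric]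
    by (simp only: mult.assoc)
  show "h0 = fls_const c' * fls_X_intpow (- int p) * fps_to_fls (fps_powi w a)"
    unfolding h0_def w fls_powi_conv_fps_powi[OF uw0(2)] ab[symmetric] add.commute[of a b]
      fls_X_intpow_times_fls_X_intpow[symmetric]
    by (simp only: mult.assoc)
  show "\<forall>j>0. fls_nth h (- int j) = fls_nth h0 (- int j)"
    by (simp add: h h0_def)
qed

text \<open>For \<open>n < p\<close> the leading exponent counts on both sides, so any common
  divisor \<open>d\<close> divides \<open>p = -(a + b)\<close> and hence divides both ranks or
  neither. The supports of the units correspond because \<open>\<theta>\<close> and
  \<open>\<tau>\<close> are inverse to each other.\<close>

lemma exp_gcd_eq_below:
  assumes n: "n < p"
  shows "exp_gcd f q n = exp_gcd h q' n"
proof (rule nat_eq_iff_dvd)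
  fix d
  obtain u w h0 where u: "\<theta> = fps_X * u" and w: "\<tau> = fps_X * w"
    and uw0: "fps_nth u 0 \<noteq> 0" "fps_nth w 0 \<noteq> 0"
    and f': "f = fls_const c * fls_X_intpow (- int p) * fps_to_fls (fps_powi u b)"
    and h': "h0 = fls_const c' * fls_X_intpow (- int p) * fps_to_fls (fps_powi w a)"
    and hh0: "\<forall>j>0. fls_nth h (- int j) = fls_nth h0 (- int j)"
    using normal_forms by metis
  have top: "fls_nth f (- int p) \<noteq> 0" "fls_nth h (- int p) \<noteq> 0"
    using c uw0 n by (auto simp: hh0 fls_nth_pole[OF f'] fls_nth_pole[OF h'] fps_powi_nth_0)
  have dvd_ab: "d dvd q \<longleftrightarrow> d dvd q'" if "d dvd p"
  proof -
    have "int d dvd a \<longleftrightarrow> int d dvd b"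
      using that ab by (metis dvd_add_left_iff dvd_add_right_iff dvd_minus_iff int_dvd_int_iff)
    thus ?thesis using a b by (metis dvd_abs_iff int_dvd_int_iff abs_ge_zero nat_0_le)
  qed
  have supp: "(\<forall>j>n. fls_nth f (- int j) \<noteq> 0 \<longrightarrow> d dvd j) \<longleftrightarrow>
      (\<forall>j>n. fls_nth h (- int j) \<noteq> 0 \<longrightarrow> d dvd j)" if d: "d dvd p"
  proof -
    have "d > 0" using d n by (auto intro: Nat.gr0I)
    have "(\<forall>j>n. fls_nth h (- int j) \<noteq> 0 \<longrightarrow> d dvd j) \<longleftrightarrow>
          (\<forall>j>n. fls_nth h0 (- int j) \<noteq> 0 \<longrightarrow> d dvd j)"
      using hh0 by auto
    also have "\<dots> \<longleftrightarrow> supported_below d (p - n) w"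
      unfolding support_iff_supported_below[OF h' c(2) d]
      using \<open>d > 0\<close> a uw0 by (simp add: supported_below_powi)
    also have "\<dots> \<longleftrightarrow> supported_below d (p - n) u"
      using supported_below_compinv[OF \<open>d > 0\<close>, of u w] supported_below_compinv[OF \<open>d > 0\<close>, of w u] inv
      unfolding u w by metis
    also have "\<dots> \<longleftrightarrow> (\<forall>j>n. fls_nth f (- int j) \<noteq> 0 \<longrightarrow> d dvd j)"
      unfolding support_iff_supported_below[OF f' c(1) d]
      using \<open>d > 0\<close> b uw0 by (simp add: supported_below_powi)
    finally show ?thesis ..
  qed
  show "d dvd exp_gcd f q n \<longleftrightarrow> d dvd exp_gcd h q' n"
    unfolding dvd_exp_gcd_iff using dvd_ab supp top n by blast
qed

lemma exp_gcd_top: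
  assumes n: "n \<ge> p"
  shows "exp_gcd f q n = q" "exp_gcd h q' n = q'"
proof -
  obtain u w h0 where
    f': "f = fls_const c * fls_X_intpow (- int p) * fps_to_fls (fps_powi u b)"
    and h': "h0 = fls_const c' * fls_X_intpow (- int p) * fps_to_fls (fps_powi w a)"
    and hh0: "\<forall>j>0. fls_nth h (- int j) = fls_nth h0 (- int j)"
    using normal_forms by metis
  show "exp_gcd f q n = q" "exp_gcd h q' n = q'"
    using n hh0 fls_nth_pole[OF f'] fls_nth_pole[OF h'] by (auto intro!: exp_gcd_eq_rank)
qed

text \<open>From \<open>a + b = -p\<close> follows \<open>-a = b\<close> modulo \<open>p\<close>, so
  the two ranks agree modulo \<open>p\<close> up to sign.\<close>

lemma pm_cong_ranks: "pm_cong q m p \<longleftrightarrow> pm_cong q' m p"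
proof -
  have abs: "pm_cong (nat \<bar>x\<bar>) m p \<longleftrightarrow> [x = int m] (mod int p) \<or> [- x = int m] (mod int p)" for x
    using cong_minus_minus_iff[of x "int m" "int p"] cong_minus_minus_iff[of x "- int m" "int p"]
      cong_minus_minus_iff[of "- x" "int m" "int p"] cong_minus_minus_iff[of "- x" "- int m" "int p"]
    by (auto simp: pm_cong_def abs_if)
  have "- a = b + int p" "- b = a + int p" using ab by auto
  moreover have "[b + int p = b] (mod int p)" "[a + int p = a] (mod int p)"
    by (simp_all add: cong_def)
  ultimately have "[- a = b] (mod int p)" "[- b = a] (mod int p)"
    by metis+
  hence "pm_cong (nat \<bar>a\<bar>) m p \<longleftrightarrow> pm_cong (nat \<bar>b\<bar>) m p"
    unfolding abs by (meson cong_sym cong_trans)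
  thus ?thesis using a b by simp
qed

text \<open>Below \<open>p\<close> the two gcds coincide, above \<open>p\<close> each is constant,
  and at \<open>i = p\<close> only the ranks differ.\<close>

lemma gcds_pm_cong_iff: "gcds_pm_cong f q \<longleftrightarrow> gcds_pm_cong h q'"
proof -
  have "pm_cong (exp_gcd f q i) (exp_gcd f q (i - 1)) i \<longleftrightarrow>
        pm_cong (exp_gcd h q' i) (exp_gcd h q' (i - 1)) i" if "i > 0" for i
  proof (cases i p rule: linorder_cases)
    case less
    thus ?thesis using exp_gcd_eq_below by simp
  next
    case greater
    thus ?thesis using exp_gcd_top by simp
  next
    case equal
    thus ?thesis using exp_gcd_top pm_cong_ranks that exp_gcd_eq_below[of "p - 1"] by simp
  qed
  thus ?thesis by (simp add: gcds_pm_cong_def)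
qed

end

section \<open>Isomorphisms between connections\<close>

lemma conn_iso_refl:
  assumes "vector_space (cscale M)"
  shows "M \<simeq>\<^sub>c M"
  unfolding conn_iso_def Vector_Spaces.linear_iff using assms by (intro exI[of _ id]) auto

lemma conn_iso_sym:
  assumes "M \<simeq>\<^sub>c N"
  shows "N \<simeq>\<^sub>c M"
proof -
  obtain \<phi> where \<phi>: "Vector_Spaces.linear (cscale M) (cscale N) \<phi>" "bij \<phi>"
    "\<And>v. \<phi> (nabla M v) = nabla N (\<phi> v)"
    using assms by (auto simp: conn_iso_def)
  have [simp]: "\<phi> (inv \<phi> v) = v" for v
    using \<phi>(2) by (simp add: bij_is_surj surj_f_inv_f)
  have eqI: "x = y" if "\<phi> x = \<phi> y" for x y
    using that \<phi>(2) by (simp add: bij_is_inj inj_eq)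
  show ?thesis
    unfolding conn_iso_def
  proof (intro exI conjI allI)
    show "bij (inv \<phi>)" using \<phi>(2) by (rule bij_imp_bij_inv)
    show "Vector_Spaces.linear (cscale N) (cscale M) (inv \<phi>)"
      using \<phi>(1) unfolding Vector_Spaces.linear_iff by (auto intro!: eqI)
    show "inv \<phi> (nabla N v) = nabla M (inv \<phi> v)" for v
      by (rule eqI) (simp add: \<phi>(3))
  qed
qed

lemma conn_iso_trans:
  assumes "M \<simeq>\<^sub>c N" "N \<simeq>\<^sub>c P"
  shows "M \<simeq>\<^sub>c P"
proof -
  obtain \<phi> \<psi> where "Vector_Spaces.linear (cscale M) (cscale N) \<phi>" "bij \<phi>"
    "\<And>v. \<phi> (nabla M v) = nabla N (\<phi> v)" "Vector_Spaces.linear (cscale N) (cscale P) \<psi>" "bij \<psi>"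
    "\<And>v. \<psi> (nabla N v) = nabla P (\<psi> v)"
    using assms by (auto simp: conn_iso_def)
  thus ?thesis
    unfolding conn_iso_def Vector_Spaces.linear_iff
    by (intro exI[of _ "\<psi> \<circ> \<phi>"]) (auto simp: bij_comp)
qed

lemma conn_iso_tensor_rank_one:
  "M \<simeq>\<^sub>c N \<Longrightarrow> tensor_rank_one M b \<simeq>\<^sub>c tensor_rank_one N b"
  unfolding conn_iso_def Vector_Spaces.linear_iff tensor_rank_one_def
  by (elim exE, rule_tac x = \<phi> in exI) auto

lemma conn_rank_iso:
  assumes "M \<simeq>\<^sub>c N"
  shows "conn_rank M = conn_rank N"
proof -
  obtain \<phi> where \<phi>: "Vector_Spaces.linear (cscale M) (cscale N) \<phi>" "bij \<phi>"
    using assms by (auto simp: conn_iso_def)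
  interpret \<phi>: Vector_Spaces.linear "cscale M" "cscale N" \<phi> by (rule \<phi>(1))
  obtain B where B: "\<phi>.vs1.independent B" "UNIV \<subseteq> \<phi>.vs1.span B" "card B = \<phi>.vs1.dim UNIV"
    using \<phi>.vs1.basis_exists[of UNIV] by metis
  have "\<phi>.vs2.independent (\<phi> ` B)"
    using B(1) \<phi>(2) by (intro \<phi>.independent_injective_image) (auto simp: bij_def intro: inj_on_subset)
  moreover have "UNIV \<subseteq> \<phi>.vs2.span (\<phi> ` B)"
    using B(2) \<phi>(2) by (simp add: \<phi>.span_image bij_def top.extremum_unique)
  ultimately have "card (\<phi> ` B) = \<phi>.vs2.dim UNIV"
    by (intro \<phi>.vs2.basis_card_eq_dim) auto
  moreover have "card (\<phi> ` B) = card B"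
    using \<phi>(2) by (intro card_image) (auto simp: bij_def intro: inj_on_subset)
  ultimately show ?thesis using B(3) by (simp add: conn_rank_def)
qed

section \<open>The basis \<open>1, t, ..., t^(q-1)\<close> and the rank of
  \<open>conn_E\<close>\<close>

lemma fls_compose_power_mult_X_power_nth:
  assumes "i < q" "k < q"
  shows "fls_nth (fls_compose_power c q * fls_X ^ i) (int q * m + int k) =
    (if i = k then fls_nth (c :: 'a :: field fls) m else 0)"
proof -
  have "fls_nth (fls_compose_power c q * fls_X ^ i) (int q * m + int k) =
      fls_nth (fls_compose_power c q) (int q * m + (int k - int i))"
    by (simp add: fls_X_power_times_conv_shift algebra_simps)
  moreover have "int q dvd int q * m + (int k - int i) \<longleftrightarrow> i = k"
  proof -
    have "int q dvd int q * m + (int k - int i) \<longleftrightarrow> int k mod int q = int i mod int q"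
      by (metis dvd_add_right_iff dvd_triv_left mod_eq_dvd_iff)
    thus ?thesis using assms by auto
  qed
  ultimately show ?thesis
    using assms by (auto simp: fls_nth_compose_power)
qed

lemma fls_residue_decomposition:
  fixes v :: "'a :: field fls"
  assumes q: "q > 0"
  obtains c where "v = (\<Sum>i<q. fls_compose_power (c i) q * fls_X ^ i)"
proof
  define c where "c i = Abs_fls (\<lambda>j. fls_nth v (int q * j + int i))" for i
  have c: "fls_nth (c i) j = fls_nth v (int q * j + int i)" for i j
  proof -
    \<comment> \<open>The minimum with 0 makes \<open>j\<close> negative, so that
      \<open>q * j \<le> j\<close> and the exponent lies below the order of \<open>v\<close>; thus
      the coefficients do define a Laurent series.\<close>
    have "fls_nth v (int q * j + int i) = 0" if "j < min 0 (fls_subdegree v) - int i" for j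
    proof -
      have "int q * j \<le> 1 * j"
        using that q by (intro mult_right_mono_neg) auto
      thus ?thesis using that by (intro fls_eq0_below_subdegree) auto
    qed
    thus ?thesis
      unfolding c_def
      by (intro nth_Abs_fls_lower_bound[where N = "min 0 (fls_subdegree v) - int i"]) auto
  qed
  show "v = (\<Sum>i<q. fls_compose_power (c i) q * fls_X ^ i)"
  proof (rule fls_eqI)
    fix n
    define k where "k = nat (n mod int q)"
    have k: "k < q" "n = int q * (n div int q) + int k"
      using q by (simp_all add: k_def nat_less_iff)
    have "fls_nth (\<Sum>i<q. fls_compose_power (c i) q * fls_X ^ i) (int q * (n div int q) + int k) =
        fls_nth v (int q * (n div int q) + int k)"
      using k(1) by (simp add: fls_nth_sum fls_compose_power_mult_X_power_nth c)
    thus "fls_nth v n = fls_nth (\<Sum>i<q. fls_compose_power (c i) q * fls_X ^ i) n"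
      using k(2) by simp
  qed
qed

lemma vector_space_conn_E: "q > 0 \<Longrightarrow> vector_space (cscale (conn_E f q))"
  using is_connection_conn_E[of q f] by (simp add: is_connection_def)

lemma conn_rank_conn_E:
  fixes f :: "'a :: field_char_0 fls"
  assumes q: "q > 0"
  shows "conn_rank (conn_E f q) = q"
proof -
  let ?s = "cscale (conn_E f q)" and ?B = "(\<lambda>i. fls_X ^ i :: 'a fls) ` {..<q}"
  interpret vector_space ?s using q by (rule vector_space_conn_E)
  have inj: "inj_on (\<lambda>i. fls_X ^ i :: 'a fls) {..<q}"
    by (auto intro!: inj_onI dest!: arg_cong[of _ _ fls_subdegree])
  have "independent ?B"
  proof (rule independent_if_scalars_zero)
    fix c x assume sum: "(\<Sum>x\<in>?B. ?s (c x) x) = 0" and "x \<in> ?B"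
    then obtain k where k: "k < q" "x = fls_X ^ k" by auto
    have "fls_nth (c x) m = 0" for m
    proof -
      have "(\<Sum>i<q. fls_compose_power (c (fls_X ^ i)) q * fls_X ^ i) = 0"
        using sum by (simp add: sum.reindex[OF inj] conn_E_def)
      from arg_cong[OF this, of "\<lambda>v. fls_nth v (int q * m + int k)"] show ?thesis
        using k by (simp add: fls_nth_sum fls_compose_power_mult_X_power_nth)
    qed
    thus "c x = 0" by (simp add: fls_eq_iff)
  qed simp
  moreover have "UNIV \<subseteq> span ?B"
  proof
    fix v :: "'a fls"
    obtain c where v: "v = (\<Sum>i<q. fls_compose_power (c i) q * fls_X ^ i)"
      using fls_residue_decomposition[OF q] .
    have "v = (\<Sum>i<q. ?s (c i) (fls_X ^ i))" by (subst v) (simp add: conn_E_def)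
    also have "\<dots> \<in> span ?B" by (intro span_sum span_scale span_base) auto
    finally show "v \<in> span ?B" .
  qed
  ultimately have "card ?B = dim UNIV"
    by (intro basis_card_eq_dim) auto
  thus ?thesis using inj by (simp add: conn_rank_def card_image)
qed

lemma tensor_rank_one_conn_E:
  assumes q: "q > 0"
  shows "tensor_rank_one (conn_E f q) (fls_const a * fls_X_intpow (- n - 1)) =
    conn_E (f + fls_const a * fls_X_intpow (- n * int q)) q"
proof -
  have "fls_compose_power (fls_const a * fls_X_intpow (- n - 1)) q =
     fls_const a * fls_X_intpow (- n * int q) / fls_X ^ q"
    using q by (simp add: algebra_simps fls_X_power_conv_shift_1 flip: times_divide_eq_right)
  thus ?thesis
    by (simp add: tensor_rank_one_def conn_E_def algebra_simps add_divide_distrib)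
qed

text \<open>Bijectivity is left out of the assumptions: an isomorphism enters the argument only
  through \<open>\<phi> 1 \<noteq> 0\<close>.\<close>

locale conn_E_morphism =
  fixes f g :: "'a :: {alg_closed_field, field_char_0} fls" and q :: nat and \<phi> :: "'a fls \<Rightarrow> 'a fls"
  assumes q: "q > 0"
    and add: "\<phi> (v + w) = \<phi> v + \<phi> w"
    and scale: "\<phi> (fls_compose_power c q * v) = fls_compose_power c q * \<phi> v"
    and nabla: "\<phi> (nabla (conn_E f q) v) = nabla (conn_E g q) (\<phi> v)"
begin

lemma scale_X_power: "\<phi> (fls_X ^ q * v) = fls_X ^ q * \<phi> v"
  using scale[of fls_X v] q by (simp add: fls_X_power_conv_shift_1)

lemma scale_of_nat: "\<phi> (of_nat n * v) = of_nat n * \<phi> v"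
  using scale[of "of_nat n" v] q by (simp add: fls_of_nat)

text \<open>Multiplication by \<open>q x = q t^q\<close>, with which \<open>\<phi>\<close> commutes,
  turns the connection into the Euler operator \<open>t d/dt\<close> plus multiplication by
  \<open>q f\<close>.\<close>

lemma nabla': "\<phi> (fls_X * fls_deriv v + of_nat q * f * v) =
    fls_X * fls_deriv (\<phi> v) + of_nat q * g * \<phi> v"
proof -
  have *: "of_nat q * (fls_X ^ q * nabla (conn_E h q) v) = fls_X * fls_deriv v + of_nat q * h * v"
    for h v :: "'a fls"
  proof -
    define n :: "'a fls" where "n = of_nat q"
    have "n \<noteq> 0" using q by (simp add: n_def)
    obtain m where m: "q = Suc m" using q gr0_conv_Suc by auto
    have "n * (fls_X ^ Suc m * (w / (n * fls_X ^ m) + h / fls_X ^ Suc m * v)) = fls_X * w + n * h * v"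
      for w :: "'a fls"
      using \<open>n \<noteq> 0\<close> by (simp add: divide_simps)
    thus ?thesis unfolding conn_E_def n_def [symmetric] by (simp add: m)
  qed
  show ?thesis
    unfolding *[symmetric] scale_of_nat scale_X_power nabla ..
qed

text \<open>
  A \<open>K((t\<^sup>q))\<close>-linear map is a combination \<open>\<phi> = \<Sum>\<^sub>z c\<^sub>z \<sigma>\<^sub>z\<close> of the rotations \<open>t \<mapsto> z t\<close> with \<open>z\<^sup>q = 1\<close>.
  For such \<open>z\<close>, this averaging operator projects \<open>\<phi>\<close> onto \<open>q c\<^sub>z \<sigma>\<^sub>z\<close>.
\<close>

definition component :: "'a \<Rightarrow> 'a fls \<Rightarrow> 'a fls" where
  "component z v = (\<Sum>i<q. inverse ((fls_const z * fls_X) ^ i) * \<phi> (fls_X ^ i * v))"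

abbreviation rotate :: "'a \<Rightarrow> 'a fls \<Rightarrow> 'a fls" where
  "rotate z v \<equiv> fls_compose_fps v (fps_const z * fps_X)"

lemma component_add: "component z (v + w) = component z v + component z w"
  by (simp add: component_def add algebra_simps sum.distrib)

lemma component_scale: "component z (fls_compose_power c q * v) = fls_compose_power c q * component z v"
  unfolding component_def sum_distrib_left
  by (intro sum.cong refl) (metis scale mult.left_commute)

lemma component_sum: "component z (\<Sum>i\<in>A. F i) = (\<Sum>i\<in>A. component z (F i))"
proof (induction A rule: infinite_finite_induct)
  have "component z 0 = 0" using component_add[of z 0 0] by simp
  thus "component z (\<Sum>i\<in>{}. F i) = (\<Sum>i\<in>{}. component z (F i))" 
    "infinite A \<Longrightarrow> component z (\<Sum>i\<in>A. F i) = (\<Sum>i\<in>A. component z (F i))" for A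
    by simp_all
qed (simp_all add: component_add)

text \<open>Multiplying the argument by \<open>fls_X\<close> shifts the summation index, and the sum
  is cyclic because \<open>(z t)^q = t^q\<close>.\<close>

lemma component_X:
  assumes z: "z ^ q = 1"
  shows "component z (fls_X * v) = fls_const z * fls_X * component z v"
proof -
  define y where "y = fls_const z * fls_X"
  have "z \<noteq> 0" using z q by (auto simp: power_0_left)
  hence y: "y \<noteq> 0" "y ^ q = fls_X ^ q"
    using z by (simp_all add: y_def power_mult_distrib flip: fls_const_power)
  define T where "T i = inverse (y ^ i) * \<phi> (fls_X ^ i * v)" for i
  have "T q = T 0"
    using y by (simp add: T_def scale_X_power)
  have "component z (fls_X * v) = (\<Sum>i<q. y * T (Suc i))"
    unfolding component_def T_def y_def [symmetric] using y
    by (intro sum.cong) (auto simp: mult_ac)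
  also have "\<dots> = y * (\<Sum>i<q. T (Suc i))"
    by (simp add: sum_distrib_left)
  also have "(\<Sum>i<q. T (Suc i)) = (\<Sum>i<q. T i)"
    using sum.lessThan_Suc_shift[of T q] \<open>T q = T 0\<close> by simp
  finally show ?thesis by (simp add: component_def T_def y_def)
qed

text \<open>By \<open>component_X\<close> the values on powers of \<open>t\<close> are determined by
  the value at 1. The base field is fixed by the rotation since \<open>z^q = 1\<close>, and the
  powers of \<open>t\<close> below \<open>q\<close> span.\<close>

lemma component_eq_rotate:
  assumes z: "z ^ q = 1"
  shows "component z v = component z 1 * rotate z v"
proof -
  have z0: "z \<noteq> 0" using z q by (auto simp: power_0_left)
  note [simp] = z0
  have X: "component z (fls_X ^ i) = (fls_const z * fls_X) ^ i * component z 1" for i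
    by (induction i) (simp_all add: component_X[OF z] mult_ac)
  have rot: "rotate z (fls_compose_power c q) = fls_compose_power c q" for c
  proof (rule fls_eqI)
    fix n
    show "fls_nth (rotate z (fls_compose_power c q)) n = fls_nth (fls_compose_power c q) n"
      using z q z0 by (auto simp: fls_nth_fls_compose_fps_linear fls_nth_compose_power power_int_mult elim!: dvdE)
  qed
  have rot_sum: "rotate z (\<Sum>i\<in>A. F i) = (\<Sum>i\<in>A. rotate z (F i))" for F and A :: "nat set"
    by (induction A rule: infinite_finite_induct) (simp_all add: fls_compose_fps_add)
  obtain c where v: "v = (\<Sum>i<q. fls_compose_power (c i) q * fls_X ^ i)"
    using fls_residue_decomposition[OF q] .
  show ?thesis
    unfolding v component_sum rot_sum sum_distrib_left component_scale X
    by (intro sum.cong refl, simp add: fls_compose_fps_mult fls_compose_fps_power rot fls_times_fps_to_fls)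
qed

text \<open>In each summand the Euler operator contributes \<open>i\<close> on \<open>t^i\<close>
  and \<open>-i\<close> on the factor \<open>(z t)^(-i)\<close>. These cancel, so the averaging
  respects the connection.\<close>

lemma component_nabla:
  assumes "z \<noteq> 0"
  shows "of_nat q * component z f = fls_X * fls_deriv (component z 1) + of_nat q * g * component z 1"
proof -
  define y where "y = fls_const z * fls_X"
  have y: "y \<noteq> 0" using assms by (simp add: y_def)
  have dy: "fls_X * fls_deriv (inverse (y ^ i)) = - of_nat i * inverse (y ^ i)" for i
  proof -
    have y': "fls_X * fls_deriv y = y" by (simp add: y_def)
    have "fls_X * fls_deriv (y ^ i) = of_nat i * y ^ i"
    proof (induction i)
      case (Suc i)
      have "fls_X * fls_deriv (y ^ Suc i) = fls_X * fls_deriv y * y ^ i + y * (fls_X * fls_deriv (y ^ i))"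
        by (simp add: algebra_simps)
      thus ?case unfolding y' Suc by (simp add: algebra_simps)
    qed simp
    hence "fls_X * fls_deriv (inverse (y ^ i)) = - (of_nat i * y ^ i) * (inverse (y ^ i))\<^sup>2"
      by (subst fls_inverse_deriv) (simp flip: mult.assoc)
    thus ?thesis using y by (simp add: power2_eq_square)
  qed
  have "of_nat q * (inverse (y ^ i) * \<phi> (fls_X ^ i * f)) =
      fls_X * fls_deriv (inverse (y ^ i) * \<phi> (fls_X ^ i)) +
      of_nat q * g * (inverse (y ^ i) * \<phi> (fls_X ^ i))" for i
  proof -
    have "fls_X * fls_deriv (fls_X ^ i) = of_nat i * (fls_X ^ i :: 'a fls)"
      by (induction i) (simp_all add: algebra_simps)
    hence "\<phi> (of_nat i * fls_X ^ i + of_nat q * (fls_X ^ i * f)) =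
        fls_X * fls_deriv (\<phi> (fls_X ^ i)) + of_nat q * g * \<phi> (fls_X ^ i)"
      using nabla'[of "fls_X ^ i"] by (simp add: mult_ac)
    hence *: "of_nat q * \<phi> (fls_X ^ i * f) = fls_X * fls_deriv (\<phi> (fls_X ^ i)) -
        of_nat i * \<phi> (fls_X ^ i) + of_nat q * g * \<phi> (fls_X ^ i)"
      unfolding add scale_of_nat by (simp add: algebra_simps)
    have "of_nat q * (inverse (y ^ i) * \<phi> (fls_X ^ i * f)) =
        inverse (y ^ i) * (of_nat q * \<phi> (fls_X ^ i * f))"
      by (simp only: mult_ac)
    also have "\<dots> = inverse (y ^ i) * (fls_X * fls_deriv (\<phi> (fls_X ^ i))) +
        (fls_X * fls_deriv (inverse (y ^ i))) * \<phi> (fls_X ^ i) +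
        of_nat q * g * (inverse (y ^ i) * \<phi> (fls_X ^ i))"
      unfolding * dy by (simp add: algebra_simps)
    finally show ?thesis by (simp add: algebra_simps)
  qed
  thus ?thesis
    unfolding component_def y_def [symmetric]
    by (simp only: fls_deriv_sum sum_distrib_left sum.distrib mult_1_right)
qed

text \<open>
  As functions of \<open>1/z\<close> the values \<open>c\<^sub>z\<close> are given by a nonzero polynomial of degree below \<open>q\<close>, which
  cannot vanish at all \<open>q\<close> roots of unity.
\<close>

lemma component_nonzero:
  assumes "\<phi> 1 \<noteq> 0"
  obtains z where "z ^ q = 1" "component z 1 \<noteq> 0"
proof (rule ccontr)
  assume neg: "\<not> thesis"
  define P where "P = (\<Sum>i<q. monom (inverse (fls_X ^ i) * \<phi> (fls_X ^ i)) i)"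
  have coeff: "coeff P i = (if i < q then inverse (fls_X ^ i) * \<phi> (fls_X ^ i) else 0)" for i
    by (simp add: P_def coeff_sum)
  have "coeff P 0 \<noteq> 0" using assms q by (simp add: coeff)
  hence "P \<noteq> 0" by auto
  have "poly P (fls_const (inverse z)) = 0" if "z ^ q = 1" for z
  proof -
    have "poly P (fls_const (inverse z)) = component z 1"
      unfolding P_def component_def poly_sum poly_monom
      by (intro sum.cong) (simp_all add: power_mult_distrib mult_ac fls_const_power fls_inverse_const flip: power_inverse)
    thus ?thesis using neg that \<open>\<And>z. \<lbrakk>z ^ q = 1; component z 1 \<noteq> 0\<rbrakk> \<Longrightarrow> thesis\<close> by auto
  qed
  hence sub: "(\<lambda>z. fls_const (inverse z)) ` {z. z ^ q = 1} \<subseteq> {x. poly P x = 0}" by auto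
  have "inj_on (\<lambda>z :: 'a. fls_const (inverse z)) {z. z ^ q = 1}"
    by (intro inj_onI) (auto dest!: arg_cong[of _ _ "\<lambda>v. fls_nth v 0"])
  hence "q = card ((\<lambda>z :: 'a. fls_const (inverse z)) ` {z. z ^ q = 1})"
    using q by (simp add: card_image card_roots_of_unity)
  also have "\<dots> \<le> card {x. poly P x = 0}"
    using sub \<open>P \<noteq> 0\<close> by (intro card_mono poly_roots_finite)
  also have "\<dots> \<le> degree P"
    using \<open>P \<noteq> 0\<close> by (rule card_poly_roots_bound)
  also have "\<dots> \<le> q - 1"
    by (intro degree_le) (auto simp: coeff)
  finally show False using q by simp
qed

text \<open>
  Comparing \<open>\<sigma>\<^sub>z\<close>-components in \<open>\<phi> \<circ> \<nabla> = \<nabla> \<circ> \<phi>\<close> gives \<open>q (\<sigma>\<^sub>z f - g) = t c\<^sub>z' / c\<^sub>z\<close>, which has no pole.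
\<close>

lemma polar_support_eq:
  assumes "\<phi> 1 \<noteq> 0" "j > 0"
  shows "fls_nth f (- int j) = 0 \<longleftrightarrow> fls_nth g (- int j) = 0"
proof -
  obtain z where z: "z ^ q = 1" "component z 1 \<noteq> 0"
    using component_nonzero[OF assms(1)] .
  have z0: "z \<noteq> 0" using z q by (auto simp: power_0_left)
  define C where "C = component z 1"
  define w where "w = of_nat q * (rotate z f - g)"
  have eq: "C * w = fls_X * fls_deriv C"
    using component_nabla[OF z0] component_eq_rotate[OF z(1), of f]
    by (simp add: C_def w_def algebra_simps)
  \<comment> \<open>A pole of \<open>w\<close> would give \<open>C * w\<close> a smaller order than
    \<open>C\<close>, whereas \<open>t d/dt\<close> never lowers the order.\<close>
  have "fls_subdegree w \<ge> 0"
  proof (rule ccontr)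
    assume neg: "\<not> fls_subdegree w \<ge> 0"
    hence "w \<noteq> 0" by auto
    hence "fls_nth (C * w) (fls_subdegree C + fls_subdegree w) \<noteq> 0"
      using z(2) by (metis C_def fls_subdegree_mult mult_eq_0_iff nth_fls_subdegree_nonzero)
    moreover have "fls_nth (fls_X * fls_deriv C) (fls_subdegree C + fls_subdegree w) = 0"
      using neg by (simp add: fls_X_times_conv_shift)
    ultimately show False using eq by simp
  qed
  hence "fls_nth w (- int j) = 0"
    using assms(2) by simp
  hence "fls_nth f (- int j) * z powi (- int j) = fls_nth g (- int j)"
    using z0 q by (simp add: w_def fls_nth_fls_compose_fps_linear fls_of_nat)
  thus ?thesis using z0 by auto
qed

end

text \<open>The transforms are relations up to isomorphism and may use another representative of the
  same connection; this makes D an invariant of the isomorphism class.\<close>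

lemma conn_E_iso:
  fixes f g :: "'a :: {alg_closed_field, field_char_0} fls"
  assumes "q > 0" "q' > 0" "conn_E f q \<simeq>\<^sub>c conn_E g q'"
  shows "q = q'" "exp_gcd f q = exp_gcd g q'"
proof -
  show qq: "q = q'"
    using conn_rank_iso[OF assms(3)] assms(1,2) by (simp add: conn_rank_conn_E)
  obtain \<phi> where \<phi>: "Vector_Spaces.linear (cscale (conn_E f q)) (cscale (conn_E g q)) \<phi>" "bij \<phi>"
    "\<And>v. \<phi> (nabla (conn_E f q) v) = nabla (conn_E g q) (\<phi> v)"
    using assms(3) unfolding conn_iso_def qq by auto
  interpret conn_E_morphism f g q \<phi>
    using \<phi> assms(1) unfolding Vector_Spaces.linear_iff by unfold_locales (auto simp: conn_E_def)
  have "\<phi> 0 = 0" using add[of 0 0] by simp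
  hence "\<phi> 1 \<noteq> 0" using \<phi>(2) by (metis bij_is_inj inj_eq zero_neq_one)
  hence "{j. n < j \<and> fls_nth f (- int j) \<noteq> 0} = {j. n < j \<and> fls_nth g (- int j) \<noteq> 0}" for n
    using polar_support_eq by auto
  thus "exp_gcd f q = exp_gcd g q'"
    by (simp add: fun_eq_iff exp_gcd_def qq)
qed

section \<open>Invariance of the congruences\<close>

lemma fps_nth_1_nonzero_if_root:
  fixes \<theta> :: "'a :: field fps"
  assumes "fps_to_fls \<theta> ^ m = F" "fls_subdegree F = int m" "m > 0"
  shows "fps_nth \<theta> 1 \<noteq> 0"
proof -
  have "int m * int (subdegree \<theta>) = int m"
    using assms by (metis fls_subdegree_pow fls_subdegree_fls_to_fps)
  hence *: "subdegree \<theta> = 1" using assms(3) by simp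
  hence "\<theta> \<noteq> 0" by auto
  thus ?thesis using * nth_subdegree_nonzero by metis
qed

text \<open>Substituting \<open>t = \<tau>(\<theta>)\<close> into \<open>c t^a \<theta>^b\<close>
  exchanges the roles of the variable and the series. The sign \<open>s\<close> covers the different
  signs in the transforms.\<close>

lemma stationary_phaseI:
  fixes f :: "'a :: {alg_closed_field, field_char_0} fls"
  assumes \<theta>: "fps_nth \<theta> 0 = 0" "fps_nth \<theta> 1 \<noteq> 0" and c: "c \<noteq> 0" "s \<noteq> 0"
    and f: "f = fls_const c * fls_X_intpow a * fps_to_fls \<theta> powi b"
    and ab: "a \<noteq> 0" "nat \<bar>a\<bar> = q" "b \<noteq> 0" "nat \<bar>b\<bar> = q'" "a + b = - int p"
  shows "stationary_phase f (fls_const s * fls_compose_fps f (fps_inv \<theta>) + fls_const k)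
    \<theta> (fps_inv \<theta>) c (s * c) k a b q q' p"
proof -
  define \<tau> where "\<tau> = fps_inv \<theta>"
  have inv: "\<theta> oo \<tau> = fps_X" "\<tau> oo \<theta> = fps_X"
    using \<theta> by (auto simp: \<tau>_def fps_inv fps_inv_right)
  have \<tau>0: "fps_nth \<tau> 0 = 0" by (simp add: \<tau>_def fps_inv_def)
  have [simp]: "\<tau> \<noteq> 0"
    using inv by auto
  have "fls_compose_fps f \<tau> = fls_const c * fps_to_fls \<tau> powi a * fls_X powi b"
    unfolding f using \<tau>0 inv
    by (simp add: fls_compose_fps_mult fls_compose_fps_powi flip: fls_X_power_int)
  hence "fls_const s * fls_compose_fps f \<tau> = fls_const (s * c) * fls_X_intpow b * fps_to_fls \<tau> powi a"
    by (simp add: mult_ac flip: fls_const_mult_const)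
  thus ?thesis
    using assms \<tau>0 inv unfolding \<tau>_def [symmetric] by unfold_locales auto
qed

lemma stationary_phase_lft_0_inf:
  fixes f :: "'a :: {alg_closed_field, field_char_0} fls"
  assumes "f \<noteq> 0" "fls_subdegree f = - int p" "q > 0" "fps_nth \<theta> 0 = 0"
    and root: "fps_to_fls \<theta> ^ (p + q) = - (fls_X ^ q / f)"
  shows "stationary_phase f (fls_compose_fps f (fps_inv \<theta>) + fls_const k)
    \<theta> (fps_inv \<theta>) (-1) (-1) k (int q) (- int (p + q)) q (p + q) p"
proof -
  have "fls_subdegree (- (fls_X ^ q / f)) = int (p + q)"
    using assms by (simp add: fls_divide_subdegree)
  hence \<theta>1: "fps_nth \<theta> 1 \<noteq> 0"
    using fps_nth_1_nonzero_if_root[OF root] assms(3) by simp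
  have "\<theta> \<noteq> 0" using \<theta>1 by auto
  have "f = - (fls_X ^ q / fps_to_fls \<theta> ^ (p + q))"
  proof -
    have *: "x \<noteq> 0 \<Longrightarrow> f = - (x / - (x / f))" for x
      using assms(1) by simp
    show ?thesis unfolding root by (rule *) simp
  qed
  hence "f = fls_const (-1) * fls_X_intpow (int q) * fps_to_fls \<theta> powi (- int (p + q))"
    by (simp add: power_int_minus field_simps fls_X_power_conv_shift_1 del: of_nat_add)
  from stationary_phaseI[OF assms(4) \<theta>1 _ _ this, of 1 q "p + q" p k] assms(3)
  show ?thesis by simp
qed

text \<open>With an integer exponent, \<open>\<theta>^(q-p) = t^q f\<close> is the defining equation
  of both transforms at infinity: the sign of \<open>q - p\<close> decides between them, and
  \<open>f = t^(-q) \<theta>^(q-p)\<close> in either case.\<close>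

lemma stationary_phase_lft_inf:
  fixes f :: "'a :: {alg_closed_field, field_char_0} fls"
  assumes "f \<noteq> 0" "fls_subdegree f = - int p" "q > 0" "p \<noteq> q" "fps_nth \<theta> 0 = 0"
    and root: "fps_to_fls \<theta> powi (int q - int p) = fls_X ^ q * f"
  shows "stationary_phase f (- fls_compose_fps f (fps_inv \<theta>) + fls_const k)
    \<theta> (fps_inv \<theta>) 1 (-1) k (- int q) (int q - int p) q (nat \<bar>int q - int p\<bar>) p"
proof -
  have "fps_to_fls \<theta> \<noteq> 0"
    using root assms(1,4) by (auto simp: power_int_0_left_if split: if_splits)
  hence "(int q - int p) * int (subdegree \<theta>) = int q - int p"
    using arg_cong[OF root, of fls_subdegree] assms(1,2) by (simp add: fls_subdegree_power_int fls_subdegree_fls_to_fps)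
  hence *: "subdegree \<theta> = 1" using assms(4) by simp
  hence \<theta>1: "fps_nth \<theta> 1 \<noteq> 0"
    by (metis nth_subdegree_nonzero subdegree_0 zero_neq_one)
  have Xq: "fls_X_intpow (- int q) = inverse (fls_X ^ q :: 'a fls)"
    by (metis fls_X_power_int power_int_minus power_int_of_nat)
  have "f = fls_const 1 * fls_X_intpow (- int q) * fps_to_fls \<theta> powi (int q - int p)"
    unfolding root using Xq by simp
  from stationary_phaseI[OF assms(5) \<theta>1 _ _ this, of "-1" q "nat \<bar>int q - int p\<bar>" p k] assms(3,4)
  show ?thesis by simp
qed

definition reduction_step ::
  "('a::field_char_0 fls, 'a fls) connection \<Rightarrow> ('a fls, 'a fls) connection \<Rightarrow> bool" where
  "reduction_step A B \<longleftrightarrow> lft_0_inf A B \<or> lft_inf_0 A B \<or> lft_inf_inf A B \<or> conn_addition A B"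

lemma reduces_to_rank_one_iff:
  "reduces_to_rank_one M \<longleftrightarrow> (\<exists>N. reduction_step\<^sup>*\<^sup>* M N \<and> conn_rank N = 1)"
  by (simp add: reduces_to_rank_one_def reduction_step_def [abs_def])

lemma lft_source_nonzero: "lft_source f q p \<Longrightarrow> f \<noteq> 0"
  by (auto simp: lft_source_def)

lemma lft_gcds_pm_cong:
  fixes M N :: "('a :: {alg_closed_field, field_char_0} fls, 'a fls) connection"
  assumes "lft_0_inf M N \<or> lft_inf_0 M N \<or> lft_inf_inf M N"
  obtains f q h q' where "q > 0" "q' > 0" "M \<simeq>\<^sub>c conn_E f q" "N \<simeq>\<^sub>c conn_E h q'"
    "gcds_pm_cong f q \<longleftrightarrow> gcds_pm_cong h q'"
  using assms
proof (elim disjE)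
  assume "lft_0_inf M N"
  then obtain f q p \<theta> where *: "lft_source f q p" "M \<simeq>\<^sub>c conn_E f q" "fps_nth \<theta> 0 = 0"
    "fps_to_fls \<theta> ^ (p + q) = - (fls_X ^ q / f)"
    "N \<simeq>\<^sub>c conn_E
          (fls_compose_fps f (fps_inv \<theta>) + fls_const (of_nat p / (2 * of_nat (p + q)))) (p + q)"
    unfolding lft_0_inf_def by blast
  have "q > 0" "fls_subdegree f = - int p" using *(1) by (simp_all add: lft_source_def)
  from stationary_phase.gcds_pm_cong_iff[OF stationary_phase_lft_0_inf[OF lft_source_nonzero[OF *(1)] this(2,1) *(3,4)]]
  show ?thesis using that[of q "p + q"] \<open>q > 0\<close> * by blast
next
  assume "lft_inf_0 M N"
  then obtain f q p \<theta> where *: "lft_source f q p" "p < q" "M \<simeq>\<^sub>c conn_E f q" "fps_nth \<theta> 0 = 0"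
    "fps_to_fls \<theta> ^ (q - p) = fls_X ^ q * f"
    "N \<simeq>\<^sub>c conn_E
          (- fls_compose_fps f (fps_inv \<theta>) + fls_const (of_nat p / (2 * of_nat (q - p)))) (q - p)"
    unfolding lft_inf_0_def by blast
  have "q > 0" "fls_subdegree f = - int p" using *(1) by (simp_all add: lft_source_def)
  moreover have "fps_to_fls \<theta> powi (int q - int p) = fls_X ^ q * f"
    using *(2,5) by (simp add: power_int_def nat_diff_distrib)
  moreover have "nat \<bar>int q - int p\<bar> = q - p" using *(2) by auto
  ultimately show ?thesis 
    using stationary_phase.gcds_pm_cong_iff[OF stationary_phase_lft_inf[OF lft_source_nonzero[OF *(1)], of p q \<theta>
      "of_nat p / (2 * of_nat (q - p))"]] that[of q "q - p"] *
    by simp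
next
  assume "lft_inf_inf M N"
  then obtain f q p \<theta> where *: "lft_source f q p" "p > q" "M \<simeq>\<^sub>c conn_E f q" "fps_nth \<theta> 0 = 0"
    "fps_to_fls \<theta> ^ (p - q) = 1 / (fls_X ^ q * f)"
    "N \<simeq>\<^sub>c conn_E
          (- fls_compose_fps f (fps_inv \<theta>) + fls_const (of_nat p / (2 * of_nat (p - q)))) (p - q)"
    unfolding lft_inf_inf_def by blast
  have "q > 0" "fls_subdegree f = - int p" using *(1) by (simp_all add: lft_source_def)
  moreover have "fps_to_fls \<theta> powi (int q - int p) = fls_X ^ q * f"
    using *(2,5) by (simp add: power_int_def nat_diff_distrib power_inverse)
  moreover have "nat \<bar>int q - int p\<bar> = p - q" using *(2) by auto
  ultimately show ?thesis 
    using stationary_phase.gcds_pm_cong_iff[OF stationary_phase_lft_inf[OF lft_source_nonzero[OF *(1)], of p q \<theta>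
      "of_nat p / (2 * of_nat (p - q))"]] that[of q "p - q"] *
    by simp
qed

lemma exp_gcd_addition:
  fixes f :: "'a :: field_char_0 fls"
  shows "exp_gcd (f + fls_const a * fls_X_intpow (- n * int q)) q = exp_gcd f q"
proof (rule exp_gcd_cong)
  fix j assume "\<not> q dvd j"
  hence "- int j \<noteq> - n * int q"
    by (metis dvd_triv_right int_dvd_int_iff dvd_minus_iff mult_minus_left)
  thus "fls_nth (f + fls_const a * fls_X_intpow (- n * int q)) (- int j) = fls_nth f (- int j)"
    by simp
qed

lemma reduction_step_gcds_pm_cong:
  fixes M N :: "('a :: {alg_closed_field, field_char_0} fls, 'a fls) connection"
  assumes "reduction_step M N" "M \<simeq>\<^sub>c conn_E f q" "q > 0"
  obtains h q' where "q' > 0" "N \<simeq>\<^sub>c conn_E h q'" "gcds_pm_cong f q \<longleftrightarrow> gcds_pm_cong h q'"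
proof (cases "conn_addition M N")
  case True
  then obtain a n where N: "N \<simeq>\<^sub>c tensor_rank_one M (fls_const a * fls_X_intpow (- n - 1))"
    by (auto simp: conn_addition_def)
  have "N \<simeq>\<^sub>c conn_E (f + fls_const a * fls_X_intpow (- n * int q)) q"
    using conn_iso_trans[OF N conn_iso_tensor_rank_one[OF assms(2)]]
    unfolding tensor_rank_one_conn_E[OF assms(3)] .
  thus ?thesis using that assms(3) gcds_pm_cong_cong[OF exp_gcd_addition] by blast
next
  case False
  with assms(1) have "lft_0_inf M N \<or> lft_inf_0 M N \<or> lft_inf_inf M N"
    by (simp add: reduction_step_def)
  then obtain f1 q1 h q' where *: "q1 > 0" "q' > 0" "M \<simeq>\<^sub>c conn_E f1 q1" "N \<simeq>\<^sub>c conn_E h q'"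
    "gcds_pm_cong f1 q1 \<longleftrightarrow> gcds_pm_cong h q'"
    by (rule lft_gcds_pm_cong)
  \<comment> \<open>The transform supplies its own representative \<open>f1\<close>,
    \<open>q1\<close> of the source, which has to be compared with \<open>f\<close>,
    \<open>q\<close>.\<close>
  have "conn_E f q \<simeq>\<^sub>c conn_E f1 q1"
    using assms(2) *(3) conn_iso_sym conn_iso_trans by blast
  from conn_E_iso[OF assms(3) *(1) this] have "gcds_pm_cong f q \<longleftrightarrow> gcds_pm_cong f1 q1"
    using gcds_pm_cong_cong by blast
  thus ?thesis using that * by blast
qed

lemma reduction_steps_gcds_pm_cong:
  fixes M N :: "('a :: {alg_closed_field, field_char_0} fls, 'a fls) connection"
  assumes "reduction_step\<^sup>*\<^sup>* (conn_E f q) N" "q > 0"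
  shows "\<exists>h q'. q' > 0 \<and> N \<simeq>\<^sub>c conn_E h q' \<and> (gcds_pm_cong f q \<longleftrightarrow> gcds_pm_cong h q')"
  using assms(1)
proof (induction rule: rtranclp_induct)
  case base
  thus ?case using assms(2) conn_iso_refl vector_space_conn_E by blast
next
  case (step M N)
  thus ?case using reduction_step_gcds_pm_cong by metis
qed

lemma reduces_imp_gcds_pm_cong:
  fixes f :: "'a :: {alg_closed_field, field_char_0} fls"
  assumes "reduces_to_rank_one (conn_E f q)" "q > 0"
  shows "gcds_pm_cong f q"
proof -
  obtain N where N: "reduction_step\<^sup>*\<^sup>* (conn_E f q) N" "conn_rank N = 1"
    using assms(1) by (auto simp: reduces_to_rank_one_iff)
  then obtain h q' where *: "q' > 0" "N \<simeq>\<^sub>c conn_E h q'" "gcds_pm_cong f q \<longleftrightarrow> gcds_pm_cong h q'"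
    using reduction_steps_gcds_pm_cong[OF N(1) assms(2)] by blast
  have "q' = 1" using conn_rank_iso[OF *(2)] N(2) *(1) by (simp add: conn_rank_conn_E)
  thus ?thesis using * gcds_pm_cong_rank_1 by metis
qed

section \<open>Lowering the rank\<close>

text \<open>After removing \<open>t^m\<close> a unit remains, and it has an \<open>m\<close>-th root
  because its constant term has one. The series \<open>\<theta>\<close> of the transforms is
  obtained in this way.\<close>

lemma fls_root_exists:
  fixes F :: "'a :: {alg_closed_field, field_char_0} fls"
  assumes "fls_subdegree F = int m" "m > 0"
  obtains \<theta> where "fps_nth \<theta> 0 = 0" "fps_to_fls \<theta> ^ m = F"
proof
  have "F \<noteq> 0" using assms by auto
  define u where "u = fls_base_factor_to_fps F"
  have u0: "fps_nth u 0 \<noteq> 0" using \<open>F \<noteq> 0\<close> by (simp add: u_def)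
  have F: "F = fls_X ^ m * fps_to_fls u"
    using assms(1) fls_conv_base_factor_to_fps_shift_subdegree[of F]
    by (simp add: u_def fls_X_power_times_conv_shift)
  \<comment> \<open>\<open>fps_radical\<close> expects a function choosing roots of the constant
    term.\<close>
  define r where "r = (\<lambda>(k::nat) (_::'a). SOME y. y ^ k = fps_nth u 0)"
  obtain l where l: "m = Suc l" using assms(2) gr0_conv_Suc by auto
  have "r (Suc l) (fps_nth u 0) ^ Suc l = fps_nth u 0"
    unfolding r_def using nth_root_exists[of "Suc l" "fps_nth u 0"] by (rule someI_ex) simp
  hence "fps_radical r m u ^ m = u"
    unfolding l using power_radical[OF u0] by blast
  thus "fps_to_fls (fps_X * fps_radical r m u) ^ m = F"
    by (simp add: F fls_times_fps_to_fls power_mult_distrib flip: fps_to_fls_power)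
  show "fps_nth (fps_X * fps_radical r m u) 0 = 0" by simp
qed

text \<open>A representative in \<open>K((x^(1/r)))\<close> with \<open>r < q\<close> would make
  \<open>q / gcd(q, r)\<close> a divisor of \<open>q\<close> and of all polar exponents, hence of
  D(0) = 1, so \<open>q\<close> would divide \<open>r\<close>.\<close>

lemma R_class_in_R_o:
  assumes "q > 0" "exp_gcd f q 0 = 1"
  shows "R_class q f \<in> R_o q"
  unfolding R_o_def
proof (intro CollectI conjI notI)
  assume "\<exists>r g. 0 < r \<and> r < q \<and> g \<in> R_class q f \<and> in_root_field q r g"
  then obtain r g where r: "0 < r" "r < q" "f - g \<in> R_null q" "in_root_field q r g"
    by (auto simp: R_class_def)
  obtain w n where "f - g = fps_to_fls (fps_X * w) + fls_const (of_int n / of_nat q)"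
    using r(3) by (auto simp: R_null_def)
  hence fg: "f = g + fps_to_fls (fps_X * w) + fls_const (of_int n / of_nat q)"
    by (simp add: algebra_simps)
  define d where "d = gcd q r"
  have "d > 0" using r by (simp add: d_def)
  have cop: "coprime (q div d) (r div d)"
    using r unfolding d_def by (intro div_gcd_coprime) auto
  have q: "q = d * (q div d)" and r': "r = d * (r div d)" by (simp_all add: d_def)
  have "q div d dvd j" if "j > 0" "fls_nth f (- int j) \<noteq> 0" for j
  proof -
    have "fls_nth g (- int j) \<noteq> 0" using that by (auto simp: fg)
    hence "int q dvd int r * (- int j)"
      using r(4) by (auto simp: in_root_field_def)
    hence "q dvd r * j" by (metis dvd_minus_iff int_dvd_int_iff mult_minus_right of_nat_mult)
    hence "d * (q div d) dvd d * (r div d * j)" using q r' by (metis mult.assoc)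
    hence "q div d dvd r div d * j" using \<open>d > 0\<close> by simp
    thus ?thesis using cop by (simp add: coprime_dvd_mult_right_iff)
  qed
  hence "q div d dvd exp_gcd f q 0"
    unfolding dvd_exp_gcd_iff using q by (metis dvd_triv_right)
  hence "q = d" using assms(2) q by simp
  hence "q dvd r" by (metis d_def gcd_dvd2)
  thus False using r by (auto dest: dvd_imp_le)
qed auto

lemma lft_sourceI:
  assumes "q > 0" "p > 0" "exp_gcd f q 0 = 1" "fls_subdegree f = - int p"
  shows "lft_source f q p"
proof -
  have "f \<noteq> 0" using assms by auto
  hence "fls_nth f (- int p) \<noteq> 0" using assms(4) by (metis nth_fls_subdegree_nonzero)
  hence "- f \<notin> R_null q" using assms(2) by (auto simp: R_null_def dest!: arg_cong[of _ _ "\<lambda>v. fls_nth v (- int p)"])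
  moreover have "f - f \<in> R_null q"
    unfolding R_null_def by (rule CollectI, rule exI[of _ 0], rule exI[of _ 0]) simp
  ultimately have "R_class q f \<noteq> R_class q 0"
    unfolding R_class_def by (metis (mono_tags, lifting) diff_0 mem_Collect_eq)
  thus ?thesis using assms R_class_in_R_o by (simp add: lft_source_def)
qed

lemma additions_reach:
  fixes f :: "'a :: field_char_0 fls"
  assumes "q > 0" "finite J"
  shows "reduction_step\<^sup>*\<^sup>* (conn_E f q)
    (conn_E (f + (\<Sum>n\<in>J. fls_const (a n) * fls_X_intpow (- n * int q))) q)"
  using assms(2)
proof (induction J)
  case (insert n J)
  let ?h = "f + (\<Sum>n\<in>J. fls_const (a n) * fls_X_intpow (- n * int q))"
  have "conn_addition (conn_E ?h q) (conn_E (?h + fls_const (a n) * fls_X_intpow (- n * int q)) q)"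
    unfolding conn_addition_def
    by (intro exI[of _ "a n"] exI[of _ n], subst tensor_rank_one_conn_E[OF assms(1)])
       (intro conn_iso_refl vector_space_conn_E assms(1))
  hence "reduction_step (conn_E ?h q) (conn_E (?h + fls_const (a n) * fls_X_intpow (- n * int q)) q)"
    by (simp add: reduction_step_def)
  with insert.IH have "reduction_step\<^sup>*\<^sup>* (conn_E f q) (conn_E (?h + fls_const (a n) * fls_X_intpow (- n * int q)) q)"
    by (rule rtranclp.rtrancl_into_rtrancl)
  thus ?case using insert.hyps by (simp add: add_ac)
qed simp

lemma remove_multiples_of_rank:
  fixes f :: "'a :: field_char_0 fls"
  assumes q: "q > 0"
  obtains h where "reduction_step\<^sup>*\<^sup>* (conn_E f q) (conn_E h q)" "exp_gcd h q = exp_gcd f q"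
    "\<forall>j. q dvd j \<longrightarrow> fls_nth h (- int j) = 0"
proof -
  \<comment> \<open>For \<open>n \<ge> 0\<close> a nonzero coefficient at \<open>-n q\<close> needs
    \<open>n \<le> n q \<le> -ord f\<close>, so this finite set suffices. It includes
    \<open>n = 0\<close>, whence the constant term disappears as well.\<close>
  define J where "J = {0..- fls_subdegree f}"
  define a where "a n = - fls_nth f (- n * int q)" for n
  define h where "h = f + (\<Sum>n\<in>J. fls_const (a n) * fls_X_intpow (- n * int q))"
  have nth: "fls_nth h i = fls_nth f i + (\<Sum>n\<in>J. if i = - n * int q then a n else 0)" for i
    unfolding h_def by (auto simp: fls_nth_sum intro!: sum.cong)
  show ?thesis
  proof
    show "reduction_step\<^sup>*\<^sup>* (conn_E f q) (conn_E h q)"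
      unfolding h_def by (rule additions_reach) (simp_all add: q J_def)
    show "exp_gcd h q = exp_gcd f q"
    proof (rule exp_gcd_cong)
      fix j assume "\<not> q dvd j"
      hence "- int j \<noteq> - n * int q" for n
        by (metis dvd_triv_right int_dvd_int_iff dvd_minus_iff mult_minus_left)
      thus "fls_nth h (- int j) = fls_nth f (- int j)"
        by (simp add: nth)
    qed
    show "\<forall>j. q dvd j \<longrightarrow> fls_nth h (- int j) = 0"
    proof (intro allI impI)
      fix j assume "q dvd j"
      then obtain n where j: "j = n * q" by (metis dvdE mult.commute)
      have "(- int j = - m * int q) \<longleftrightarrow> m = int n" for m
        using q by (auto simp: j)
      hence h: "fls_nth h (- int j) = fls_nth f (- int j) + (if int n \<in> J then a (int n) else 0)"
        by (simp add: nth J_def)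
      have "fls_nth f (- int j) = 0" if "int n \<notin> J"
      proof (rule fls_eq0_below_subdegree)
        have "n \<le> j" using q by (simp add: j)
        thus "- int j < fls_subdegree f" using that by (auto simp: J_def)
      qed
      thus "fls_nth h (- int j) = 0" using h by (auto simp: a_def j)
    qed
  qed
qed

text \<open>Strong induction on the rank. The condition D(0) = 1 ensures that the transforms are
  applicable and is inherited by the transformed series, as are the congruences.\<close>

lemma gcds_pm_cong_imp_reduces:
  fixes f :: "'a :: {alg_closed_field, field_char_0} fls"
  assumes "q > 0" "exp_gcd f q 0 = 1" "gcds_pm_cong f q"
  shows "reduces_to_rank_one (conn_E f q)"
  using assms
proof (induction q arbitrary: f rule: less_induct)
  case (less q f)
  show ?case
  proof (cases "q = 1")
    case True
    thus ?thesis using conn_rank_conn_E[of 1 f] by (auto simp: reduces_to_rank_one_iff)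
  next
    case False
    obtain f' where reach: "reduction_step\<^sup>*\<^sup>* (conn_E f q) (conn_E f' q)"
      and D: "exp_gcd f' q = exp_gcd f q" and mult: "\<forall>j. q dvd j \<longrightarrow> fls_nth f' (- int j) = 0"
      using remove_multiples_of_rank[OF less.prems(1), of f] .
    have D0: "exp_gcd f' q 0 = 1" and cong: "gcds_pm_cong f' q"
      using less.prems D gcds_pm_cong_cong[OF D] by simp_all
    have "\<not> q dvd exp_gcd f' q 0" using D0 False by simp
    then obtain j where j: "j > 0" "fls_nth f' (- int j) \<noteq> 0"
      unfolding dvd_exp_gcd_iff by auto
    define p where "p = nat (- fls_subdegree f')"
    have "fls_subdegree f' \<le> - int j" using j by (intro fls_subdegree_leI)
    hence p: "p > 0" "fls_subdegree f' = - int p" using j by (simp_all add: p_def)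
    have "f' \<noteq> 0" using j by auto
    hence "fls_nth f' (- int p) \<noteq> 0" using p(2) by (metis nth_fls_subdegree_nonzero)
    \<comment> \<open>All multiples of \<open>q\<close> have been removed, so the pole order
      \<open>p\<close> is the first characteristic exponent and \<open>gcd q p\<close> is the next
      value of D.\<close>
    hence qp: "\<not> q dvd p" using mult by auto
    hence "p \<noteq> q" by auto
    have src: "lft_source f' q p" using lft_sourceI less.prems(1) p D0 by blast
    have gcd: "exp_gcd f' q (p - 1) = gcd q p" "exp_gcd f' q p = q"
      using exp_gcd_ge_pole[OF p(2), of p q] exp_gcd_pred[OF p(1), of f' q] \<open>fls_nth f' (- int p) \<noteq> 0\<close>
      by simp_all
    have iso: "conn_E h q \<simeq>\<^sub>c conn_E h q" if "q > 0" for h :: "'a fls" and q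
      using that by (intro conn_iso_refl vector_space_conn_E)
    define m where "m = nat \<bar>int q - int p\<bar>"
    have "m > 0" using \<open>p \<noteq> q\<close> by (simp add: m_def)
    \<comment> \<open>Common to both transforms at infinity, once the new rank \<open>m\<close> is
      known to be smaller than \<open>q\<close>.\<close>
    have reduce: "reduces_to_rank_one (conn_E f q)"
      if *: "fps_to_fls \<theta> powi (int q - int p) = fls_X ^ q * f'" "fps_nth \<theta> 0 = 0" "m < q"
        "h = - fls_compose_fps f' (fps_inv \<theta>) + fls_const (of_nat p / (2 * of_nat m))"
        "reduction_step (conn_E f' q) (conn_E h m)" for \<theta> h
    proof -
      interpret stationary_phase f' h \<theta> "fps_inv \<theta>" 1 "-1" "of_nat p / (2 * of_nat m)" "- int q" "int q - int p" q m p
        unfolding *(4) m_def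
        by (rule stationary_phase_lft_inf) (use * \<open>f' \<noteq> 0\<close> p less.prems(1) \<open>p \<noteq> q\<close> in auto)
      have "reduces_to_rank_one (conn_E h m)"
        using less.IH[of m h] *(3) \<open>m > 0\<close> gcds_pm_cong_iff cong exp_gcd_eq_below[OF p(1)] D0 by simp
      thus ?thesis
        unfolding reduces_to_rank_one_iff using reach *(5)
        by (meson converse_rtranclp_into_rtranclp rtranclp_trans)
    qed
    show ?thesis
    proof (cases "p < q")
      case True
      hence m: "m = q - p" by (simp add: m_def)
      have "fls_subdegree (fls_X ^ q * f') = int m"
        using \<open>f' \<noteq> 0\<close> p True by (simp add: m)
      then obtain \<theta> where \<theta>: "fps_nth \<theta> 0 = 0" "fps_to_fls \<theta> ^ m = fls_X ^ q * f'"
        using fls_root_exists \<open>m > 0\<close> by blast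
      have "lft_inf_0 (conn_E f' q)
         (conn_E (- fls_compose_fps f' (fps_inv \<theta>) + fls_const (of_nat p / (2 * of_nat m))) m)"
        unfolding lft_inf_0_def m
        by (rule exI[of _ f'], rule exI[of _ q], rule exI[of _ p], rule exI[of _ \<theta>])
           (use src True iso \<open>m > 0\<close> \<theta> less.prems(1) in \<open>simp add: m\<close>)
      moreover have "fps_to_fls \<theta> powi (int q - int p) = fls_X ^ q * f'"
        using True \<theta> by (simp add: power_int_def m nat_diff_distrib)
      moreover have "m < q" using p(1) True by (simp add: m)
      ultimately show ?thesis using reduce \<theta> by (auto simp: reduction_step_def)
    next
      case False
      hence pq: "p > q" using \<open>p \<noteq> q\<close> by simp
      hence m: "m = p - q" by (simp add: m_def)
      \<comment> \<open>The congruence at \<open>i = p\<close> relates \<open>q\<close> and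
        \<open>gcd q p\<close>; with \<open>gcd q p < q < p\<close> it forces
        \<open>p = q + gcd q p\<close>, so the new rank \<open>p - q\<close> is a proper divisor of
        \<open>q\<close>.\<close>
      have "m < q"
      proof -
        have "pm_cong q (gcd q p) p"
          using cong[unfolded gcds_pm_cong_def, rule_format, OF p(1)] gcd by simp
        moreover have "gcd q p < q"
          using qp less.prems(1) gcd_le1_nat[of q p] by (metis gcd_dvd2 le_neq_implies_less not_gr0)
        ultimately have "p = q + gcd q p"
          using pq by (intro pm_cong_less_imp_eq)
        thus ?thesis using \<open>gcd q p < q\<close> by (simp add: m)
      qed
      have "fls_subdegree (1 / (fls_X ^ q * f')) = int m"
        using \<open>f' \<noteq> 0\<close> p pq by (simp add: m fls_divide_subdegree)
      then obtain \<theta> where \<theta>: "fps_nth \<theta> 0 = 0" "fps_to_fls \<theta> ^ m = 1 / (fls_X ^ q * f')"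
        using fls_root_exists \<open>m > 0\<close> by blast
      have "lft_inf_inf (conn_E f' q)
         (conn_E (- fls_compose_fps f' (fps_inv \<theta>) + fls_const (of_nat p / (2 * of_nat m))) m)"
        unfolding lft_inf_inf_def m
        by (rule exI[of _ f'], rule exI[of _ q], rule exI[of _ p], rule exI[of _ \<theta>])
           (use src pq iso \<open>m > 0\<close> \<theta> less.prems(1) in \<open>simp add: m\<close>)
      moreover have "fps_to_fls \<theta> powi (int q - int p) = fls_X ^ q * f'"
        using pq \<theta> by (simp add: power_int_def m nat_diff_distrib power_inverse)
      ultimately show ?thesis using reduce \<theta> \<open>m < q\<close> by (auto simp: reduction_step_def)
    qed
  qed
qed

section \<open>Comparison with the dual Puiseux characteristic\<close>

lemma dual_puiseux_char_iff:
  assumes "dual_puiseux_char f q p g \<beta> e"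
  shows "exp_gcd f q 0 = 1" "gcds_pm_cong f q \<longleftrightarrow> (\<forall>i\<in>{1..g}. pm_cong (e (i - 1)) (e i) (\<beta> i))"
proof -
  \<comment> \<open>An index at which D takes the value \<open>e k\<close>: D equals
    \<open>q\<close> from the pole order on, and reaches \<open>e k\<close> just after the exponent
    \<open>-\<beta> k\<close> has been included.\<close>
  define b where "b k = (if k = 0 then p else \<beta> k - 1)" for k
  have step: "fls_nth f (- int (\<beta> k)) \<noteq> 0" "\<not> e (k - 1) dvd \<beta> k" "e k = gcd (e (k - 1)) (\<beta> k)"
    "\<And>j. fls_nth f (- int j) \<noteq> 0 \<Longrightarrow> \<not> e (k - 1) dvd j \<Longrightarrow> j \<le> \<beta> k" if "k \<in> {1..g}" for k
    using assms that by (auto simp: dual_puiseux_char_def Let_def dest!: bspec[of _ _ k] spec[of _ "- int j" for j])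
  have "exp_gcd f q (b k) = e k \<and>
    ((\<forall>i>b k. pm_cong (exp_gcd f q i) (exp_gcd f q (i - 1)) i) \<longleftrightarrow>
     (\<forall>i\<in>{1..k}. pm_cong (e (i - 1)) (e i) (\<beta> i)))" if "k \<le> g" for k
    using that
  proof (induction k)
    case 0
    have sub: "fls_subdegree f = - int p" "e 0 = q" using assms by (simp_all add: dual_puiseux_char_def)
    hence "exp_gcd f q i = q" if "i \<ge> p" for i using that by (intro exp_gcd_ge_pole)
    thus ?case using sub by (auto simp: b_def)
  next
    case (Suc k)
    have IH: "exp_gcd f q (b k) = e k" 
      "(\<forall>i>b k. pm_cong (exp_gcd f q i) (exp_gcd f q (i - 1)) i) \<longleftrightarrow>
       (\<forall>i\<in>{1..k}. pm_cong (e (i - 1)) (e i) (\<beta> i))"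
      using Suc by auto
    note s = step[of "Suc k", simplified]
    have pos: "\<beta> (Suc k) > 0" using s(2) Suc.prems by (auto intro!: Nat.gr0I)
    \<comment> \<open>Otherwise \<open>\<beta> (Suc k)\<close> would be among the exponents entering
      D at \<open>b k\<close>, and \<open>e k\<close> would divide it.\<close>
    have "\<beta> (Suc k) \<le> b k"
    proof (rule ccontr)
      assume "\<not> \<beta> (Suc k) \<le> b k"
      hence "exp_gcd f q (b k) dvd \<beta> (Suc k)"
        using dvd_exp_gcd_iff[of "exp_gcd f q (b k)" f q "b k"] s(1) Suc.prems by auto
      thus False using IH s(2) Suc.prems by simp
    qed
    moreover have "e k dvd exp_gcd f q (\<beta> (Suc k))"
      unfolding dvd_exp_gcd_iff
    proof (intro conjI allI impI)
      show "e k dvd q" using IH dvd_exp_gcd_iff[of "exp_gcd f q (b k)" f q "b k"] by simp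
      show "e k dvd j" if "\<beta> (Suc k) < j" "fls_nth f (- int j) \<noteq> 0" for j
        using s(4)[of j] that Suc.prems by fastforce
    qed
    \<comment> \<open>By monotonicity under divisibility, D is squeezed to the constant
      \<open>e k\<close> on this interval, so its next drop occurs exactly at
      \<open>\<beta> (Suc k)\<close>.\<close>
    ultimately have const: "exp_gcd f q i = e k" if "\<beta> (Suc k) \<le> i" "i \<le> b k" for i
      using that exp_gcd_mono[of "\<beta> (Suc k)" i f q] exp_gcd_mono[of i "b k" f q] IH
      by (metis dvd_antisym dvd_trans)
    have new: "exp_gcd f q (\<beta> (Suc k) - 1) = e (Suc k)"
      using exp_gcd_pred[OF pos, of f q] const[of "\<beta> (Suc k)"] \<open>\<beta> (Suc k) \<le> b k\<close> s(1,3) Suc.prems by simp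
    have "(\<forall>i>b (Suc k). pm_cong (exp_gcd f q i) (exp_gcd f q (i - 1)) i) \<longleftrightarrow>
        pm_cong (e k) (e (Suc k)) (\<beta> (Suc k)) \<and>
        (\<forall>i>b k. pm_cong (exp_gcd f q i) (exp_gcd f q (i - 1)) i)"
      (is "?L \<longleftrightarrow> ?A \<and> ?B")
    proof
      assume L: ?L
      have ?A using L[rule_format, of "\<beta> (Suc k)"] pos new const[of "\<beta> (Suc k)"] \<open>\<beta> (Suc k) \<le> b k\<close>
        by (simp add: b_def)
      moreover have ?B using L \<open>\<beta> (Suc k) \<le> b k\<close> by (auto simp: b_def)
      ultimately show "?A \<and> ?B" ..
    next
      assume AB: "?A \<and> ?B"
      show ?L
      proof (intro allI impI)
        fix i assume "i > b (Suc k)"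
        then consider "i = \<beta> (Suc k)" | "\<beta> (Suc k) \<le> i - 1" "i \<le> b k" | "i > b k"
          using pos by (force simp: b_def)
        thus "pm_cong (exp_gcd f q i) (exp_gcd f q (i - 1)) i"
        proof cases
          case 1
          thus ?thesis using AB new const[of i] \<open>\<beta> (Suc k) \<le> b k\<close> by simp
        next
          case 2
          thus ?thesis using const[of i] const[of "i - 1"] by simp
        qed (use AB in simp)
      qed
    qed
    moreover have "{1..Suc k} = insert (Suc k) {1..k}" by auto
    ultimately show ?case using IH new by (simp add: b_def)
  qed
  from this[of g] have g: "exp_gcd f q (b g) = 1"
    "(\<forall>i>b g. pm_cong (exp_gcd f q i) (exp_gcd f q (i - 1)) i) \<longleftrightarrow>
     (\<forall>i\<in>{1..g}. pm_cong (e (i - 1)) (e i) (\<beta> i))"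
    using assms by (auto simp: dual_puiseux_char_def)
  have one: "exp_gcd f q i = 1" if "i \<le> b g" for i
    using exp_gcd_mono[OF that, of f q] g(1) by simp
  show "exp_gcd f q 0 = 1" using one[of 0] by simp
  \<comment> \<open>Up to \<open>b g\<close> the function D is constantly 1, so the remaining
    congruences are trivial.\<close>
  have "gcds_pm_cong f q \<longleftrightarrow> (\<forall>i>b g. pm_cong (exp_gcd f q i) (exp_gcd f q (i - 1)) i)"
    unfolding gcds_pm_cong_def using one
    by (metis (no_types, lifting) diff_le_self le_trans not_le pm_cong_refl bot_nat_0.not_eq_extremum less_zeroE)
  thus "gcds_pm_cong f q \<longleftrightarrow> (\<forall>i\<in>{1..g}. pm_cong (e (i - 1)) (e i) (\<beta> i))"
    using g(2) by simp
qed

theorem theorem0p3: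
  fixes f :: "'a::{alg_closed_field, field_char_0} fls"
    and q p g :: nat and \<beta> e :: "nat \<Rightarrow> nat"
  assumes "q > 0"
    and "conn_irreducible (conn_E f q)"
    and "R_class q f \<in> R_o q - {R_class q 0}"
    and "dual_puiseux_char f q p g \<beta> e"
  shows "reduces_to_rank_one (conn_E f q) \<longleftrightarrow>
    (\<forall>i\<in>{1..g}. [int (e (i - 1)) = int (e i)] (mod int (\<beta> i)) \<or>
                [int (e (i - 1)) = - int (e i)] (mod int (\<beta> i)))"
  using reduces_imp_gcds_pm_cong[OF _ assms(1)] dual_puiseux_char_iff[OF assms(4)]
    gcds_pm_cong_imp_reduces[OF assms(1)]
  by (auto simp: pm_cong_def)

end
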